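(* For every odd integer $n\geq 5$, the tight lower bound $low(n)$ on the dimensions of the maximal faces of the cone $\mathbb{CP}(n)$ of completely positive $n\times n$ matrices is equal to $n$, i.e. $low(n)=n$.
   Context: $\mathbb{S}(n)$ denotes the space of real symmetric $n\times n$ matrices. The cone of completely positive matrices is $\mathbb{CP}(n):=\mathrm{cone}\{\mathbf{x}\mathbf{x}^\top:\ \mathbf{x}\in\mathbb{R}^n_+\}\subset\mathbb{S}(n)$, the set of all finite conic (nonnegative linear) combinations of matrices $\mathbf{x}\mathbf{x}^\top$ with $\mathbf{x}$ in the nonnegative orthant $\mathbb{R}^n_+$. A nonempty convex subset $\mathcal{F}$ of a convex cone $\mathcal{K}$ is a face of $\mathcal{K}$ if $\alpha x+(1-\alpha)y\in\mathcal{F}$ with $x,y\in\mathcal{K}$ and $\alpha\in(0,1)$ implies $x,y\in\mathcal{F}$. A face $\mathcal{F}$ is a maximal face of $\mathcal{K}$ if $\mathcal{F}\neq\mathcal{K}$ and there is no other face $\bar{\mathcal{F}}\neq\mathcal{K}$ of $\mathcal{K}$ with $\mathcal{F}\subset\bar{\mathcal{F}}$. The dimension of a face is the dimension of its affine hull. $low(n):=\min\{\dim(\mathcal{F}):\ \mathcal{F}\text{ is a maximal face of }\mathbb{CP}(n)\}$. *)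

theory Defs
  imports "HOL-Analysis.Analysis"
begin

definition outer_square :: "real^'n \<Rightarrow> real^'n^'n" where
  "outer_square x = (\<chi> i j. x $ i * x $ j)"

definition conic_combinations :: "'a::real_vector set \<Rightarrow> 'a set" where
  "conic_combinations G =
     {\<Sum>A\<in>T. c A *\<^sub>R A | T c. finite T \<and> T \<subseteq> G \<and> (\<forall>A\<in>T. 0 \<le> c A)}"

lemma conic_combinationsI:
  assumes "finite T" "T \<subseteq> G" "\<forall>A\<in>T. 0 \<le> c A"
  shows "(\<Sum>A\<in>T. c A *\<^sub>R A) \<in> conic_combinations G"
  unfolding conic_combinations_def using assms by blast

lemma conic_combinationsE:
  assumes "A \<in> conic_combinations G"
  obtains T c where "finite T" "T \<subseteq> G" "\<forall>X\<in>T. 0 \<le> c X" "A = (\<Sum>X\<in>T. c X *\<^sub>R X)"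
  using assms unfolding conic_combinations_def mem_Collect_eq by (elim exE conjE)

lemma conic_combinations_add:
  assumes "A \<in> conic_combinations G" "B \<in> conic_combinations G"
  shows "A + B \<in> conic_combinations G"
proof -
  obtain T c where T: "finite T" "T \<subseteq> G" "\<forall>X\<in>T. 0 \<le> c X" "A = (\<Sum>X\<in>T. c X *\<^sub>R X)"
    using assms(1) by (rule conic_combinationsE)
  obtain U d where U: "finite U" "U \<subseteq> G" "\<forall>X\<in>U. 0 \<le> d X" "B = (\<Sum>X\<in>U. d X *\<^sub>R X)"
    using assms(2) by (rule conic_combinationsE)
  define e where "e X = (if X \<in> T then c X else 0) + (if X \<in> U then d X else 0)" for X
  have "A = (\<Sum>X\<in>T \<union> U. (if X \<in> T then c X else 0) *\<^sub>R X)"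
    unfolding T(4) by (rule sum.mono_neutral_cong_left) (use T(1) U(1) in auto)
  moreover have "B = (\<Sum>X\<in>T \<union> U. (if X \<in> U then d X else 0) *\<^sub>R X)"
    unfolding U(4) by (rule sum.mono_neutral_cong_left) (use T(1) U(1) in auto)
  ultimately have "A + B = (\<Sum>X\<in>T \<union> U. e X *\<^sub>R X)"
    by (simp only: e_def scaleR_add_left sum.distrib)
  moreover have "\<forall>X\<in>T \<union> U. 0 \<le> e X"
    using T(3) U(3) by (simp add: e_def)
  ultimately show ?thesis
    using conic_combinationsI[of "T \<union> U" G e] T(1,2) U(1,2) by simp
qed

lemma conic_combinations_scale:
  assumes "A \<in> conic_combinations G" "0 \<le> r"
  shows "r *\<^sub>R A \<in> conic_combinations G"
proof -
  obtain T c where T: "finite T" "T \<subseteq> G" "\<forall>X\<in>T. 0 \<le> c X" "A = (\<Sum>X\<in>T. c X *\<^sub>R X)"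
    using assms(1) by (rule conic_combinationsE)
  have "r *\<^sub>R A = (\<Sum>X\<in>T. (r * c X) *\<^sub>R X)"
    by (simp add: T(4) scaleR_sum_right)
  moreover have "\<forall>X\<in>T. 0 \<le> r * c X"
    using T(3) assms(2) by simp
  ultimately show ?thesis
    using conic_combinationsI[of T G "\<lambda>X. r * c X"] T(1,2) by simp
qed

lemma conic_combinations_eq_hull: "conic_combinations G = convex_cone hull G"
proof (rule antisym)
  have "(\<Sum>A\<in>T. c A *\<^sub>R A) \<in> convex_cone hull G"
    if "finite T" "T \<subseteq> G" "\<forall>A\<in>T. 0 \<le> c A" for T c
    using that
    by (induction T rule: finite_induct)
      (simp_all add: convex_cone_hull_contains_0 convex_cone_hull_add convex_cone_hull_mul hull_inc)
  then show "conic_combinations G \<subseteq> convex_cone hull G"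
    by (auto elim!: conic_combinationsE)
  have "0 \<in> conic_combinations G"
    using conic_combinationsI[of "{}" G "\<lambda>_. 0"] by simp
  then have "convex_cone (conic_combinations G)"
    unfolding convex_cone_iff
    by (intro conjI ballI allI impI conic_combinations_add conic_combinations_scale)
  moreover have "A \<in> conic_combinations G" if "A \<in> G" for A
    using conic_combinationsI[of "{A}" G "\<lambda>_. 1"] that by simp
  ultimately show "convex_cone hull G \<subseteq> conic_combinations G"
    by (intro hull_minimal subsetI)
qed

definition completely_positive_cone :: "(real^'n^'n) set" where
  "completely_positive_cone = conic_combinations {outer_square x | x. \<forall>i. 0 \<le> x $ i}"

text \<open>The library relation \<open>face_of\<close> also holds for the empty set, hence the
  explicit nonemptiness.\<close>

definition maximal_face_of :: "'a::real_vector set \<Rightarrow> 'a set \<Rightarrow> bool" where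
  "maximal_face_of F K \<longleftrightarrow>
     F \<noteq> {} \<and> F face_of K \<and> F \<noteq> K \<and>
     \<not> (\<exists>F'. F' \<noteq> {} \<and> F' face_of K \<and> F' \<noteq> K \<and> F \<subset> F')"

text \<open>The matrix order is the cardinality of the index type \<open>'n\<close>.\<close>

definition low :: "'n::finite itself \<Rightarrow> int" where
  "low _ = Min {aff_dim F | F. maximal_face_of F (completely_positive_cone :: (real^'n^'n) set)}"

text \<open>The set under the minimum is finite and nonempty, so \<open>Min\<close> is an attained minimum.\<close>

lemma finite_aff_dims: "finite {aff_dim F | F :: 'a::euclidean_space set. P F}"
proof (rule finite_subset)
  show "{aff_dim F | F :: 'a set. P F} \<subseteq> {-1..int DIM('a)}"
    by (auto simp: aff_dim_geq aff_dim_le_DIM)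
qed simp

lemma convex_completely_positive_cone: "convex completely_positive_cone"
  by (simp add: completely_positive_cone_def conic_combinations_eq_hull convex_convex_cone_hull)

lemma maximal_face_exists:
  "\<exists>F. maximal_face_of F (completely_positive_cone :: (real^'n^'n) set)"
proof -
  let ?K = "completely_positive_cone :: (real^'n^'n) set"
  let ?proper = "\<lambda>F. F \<noteq> {} \<and> F face_of ?K \<and> F \<noteq> ?K"
  define one :: "real^'n" where "one = (\<chi> i. 1)"
  have nonneg: "0 \<le> A $ i $ j" if A: "A \<in> ?K" for A i j
  proof -
    obtain T c where T: "finite T" "T \<subseteq> {outer_square x | x :: real^'n. \<forall>i. 0 \<le> x $ i}"
        "\<forall>X\<in>T. 0 \<le> c X" "A = (\<Sum>X\<in>T. c X *\<^sub>R X)"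
      using A unfolding completely_positive_cone_def by (rule conic_combinationsE)
    have "0 \<le> X $ i $ j" if "X \<in> T" for X
      using T(2) that by (auto simp: outer_square_def)
    then show ?thesis
      using T(3) by (auto simp: T(4) intro!: sum_nonneg)
  qed
  have K0: "0 \<in> ?K"
    by (simp add: completely_positive_cone_def conic_combinations_eq_hull convex_cone_hull_contains_0)
  have K1: "outer_square one \<in> ?K"
    unfolding completely_positive_cone_def conic_combinations_eq_hull
    by (rule hull_inc) (auto simp: one_def)
  have "outer_square one \<noteq> 0"
    by (simp add: outer_square_def one_def vec_eq_iff)
  then have "{0} \<noteq> ?K"
    using K1 by blast
  moreover have "{0} face_of ?K"
    unfolding face_of_singleton extreme_point_of_def
  proof (intro conjI ballI K0 notI)
    fix A B assume AB: "A \<in> ?K" "B \<in> ?K" and "0 \<in> open_segment A B"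
    then obtain u where u: "A \<noteq> B" "0 < u" "u < 1" "0 = (1 - u) *\<^sub>R A + u *\<^sub>R B"
      by (auto simp: in_segment)
    have "A $ i $ j = 0 \<and> B $ i $ j = 0" for i j
    proof -
      have "(1 - u) * A $ i $ j + u * B $ i $ j = 0"
        using arg_cong[OF u(4), of "\<lambda>M. M $ i $ j"] by simp
      moreover have "0 \<le> (1 - u) * A $ i $ j" "0 \<le> u * B $ i $ j"
        using u(2,3) nonneg[OF AB(1)] nonneg[OF AB(2)] by simp_all
      ultimately show ?thesis
        using u(2,3) by (simp add: add_nonneg_eq_0_iff)
    qed
    then show False
      using u(1) by (simp add: vec_eq_iff)
  qed
  ultimately have "?proper {0}"
    by simp
  then have ne: "{aff_dim F | F. ?proper F} \<noteq> {}"
    by blast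
  define d where "d = Max {aff_dim F | F. ?proper F}"
  have "d \<in> {aff_dim F | F. ?proper F}"
    unfolding d_def using finite_aff_dims ne by (rule Max_in)
  then obtain F where F: "?proper F" "d = aff_dim F"
    by blast
  have "\<not> (?proper F' \<and> F \<subset> F')" for F'
  proof
    assume F': "?proper F' \<and> F \<subset> F'"
    then have "F face_of F'"
      using F(1) by (meson face_of_imp_subset face_of_subset psubset_imp_subset)
    then have "aff_dim F < aff_dim F'"
      using F' by (intro face_of_aff_dim_lt) (auto dest: face_of_imp_convex)
    moreover have "aff_dim F' \<le> d"
      unfolding d_def using F' by (intro Max_ge finite_aff_dims) blast
    ultimately show False
      using F(2) by simp
  qed
  then show ?thesis
    using F(1) unfolding maximal_face_of_def by blast
qed

lemma low_attained:
  "\<exists>F. maximal_face_of F (completely_positive_cone :: (real^'n^'n) set) \<and> aff_dim F = low TYPE('n)"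
proof -
  have "low TYPE('n) \<in>
      {aff_dim F | F. maximal_face_of F (completely_positive_cone :: (real^'n^'n) set)}"
    unfolding low_def using maximal_face_exists by (intro Min_in finite_aff_dims) blast
  then show ?thesis
    by auto
qed

end

theory Submission
  imports Defs
begin

text \<open>Lower bound. For a maximal face \<open>F\<close> let \<open>Z\<close> be the set of nonnegative \<open>x\<close> with \<open>x x\<^sup>T\<close> in \<open>F\<close>.
  If \<open>Z\<close> spans the space, then \<open>n\<close> independent vectors of \<open>Z\<close> have independent squares. Otherwise
  \<open>Z\<close> lies in a hyperplane, maximality forces \<open>Z\<close> to be the whole nonnegative part of it, and the
  squares of a basis \<open>b\<^sub>1, \<dots>, b\<^bsub>n-1\<^esub>\<close> together with that of \<open>b\<^sub>1 + b\<^sub>2\<close> are \<open>n\<close> independent elements.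

  Upper bound. On the vertices of a regular \<open>n\<close>-gon with \<open>n\<close> odd, consider the circulant matrix
  \<open>A = I - a J - b C\<close>, where \<open>J\<close> is the all-ones matrix and \<open>C i j\<close> the cosine of the angle between
  \<open>i\<close> and \<open>j\<close>. For suitable \<open>a, b\<close> it is copositive and its nonnegative zeros are exactly the \<open>n\<close> rays
  spanned by the rotations \<open>u k\<close> of one vector vanishing at two neighbouring vertices. So the face
  exposed by \<open>A\<close> has dimension at most \<open>n\<close>. It is maximal, since a copositive matrix \<open>B\<close> with the same
  zeros is a multiple of \<open>A\<close>: the vector \<open>B *v u k\<close> is supported on the two zeros of \<open>u k\<close>,
  symmetry of \<open>B\<close> turns this into a recurrence along the polygon, and a discrete maximum principle
  leaves only the constant solution.\<close>

section \<open>Rank-one squares, copositive forms and faces of the cone\<close>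

lemma outer_square_nth [simp]: "outer_square x $ i $ j = x $ i * x $ j"
  by (simp add: outer_square_def)

lemma inner_outer_square: "A \<bullet> outer_square x = x \<bullet> (A *v x)"
  by (simp add: inner_vec_def matrix_vector_mult_def sum_distrib_left mult_ac)

lemma outer_square_vector_mult: "outer_square x *v v = (x \<bullet> v) *\<^sub>R x"
  by (simp add: vec_eq_iff inner_vec_def matrix_vector_mult_def sum_distrib_left mult_ac)

lemma inner_outer_squares: "outer_square w \<bullet> outer_square x = (w \<bullet> x)\<^sup>2"
  by (simp add: inner_outer_square outer_square_vector_mult inner_commute power2_eq_square)

lemma outer_square_in_cone: "(\<And>i. 0 \<le> x $ i) \<Longrightarrow> outer_square x \<in> completely_positive_cone"
  unfolding completely_positive_cone_def conic_combinations_eq_hull by (rule hull_inc) auto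

lemma zero_in_cone: "0 \<in> completely_positive_cone"
  by (simp add: completely_positive_cone_def conic_combinations_eq_hull convex_cone_hull_contains_0)

lemma scale_in_cone:
  "X \<in> completely_positive_cone \<Longrightarrow> 0 \<le> r \<Longrightarrow> r *\<^sub>R X \<in> completely_positive_cone"
  by (simp add: completely_positive_cone_def conic_combinations_scale)

lemma completely_positive_coneE:
  fixes X :: "real^'n^'n"
  assumes "X \<in> completely_positive_cone"
  obtains T c where "finite T" "\<forall>Y\<in>T. 0 \<le> c Y" "X = (\<Sum>Y\<in>T. c Y *\<^sub>R Y)"
    "\<And>Y. Y \<in> T \<Longrightarrow> \<exists>x. (\<forall>i. 0 \<le> x $ i) \<and> Y = outer_square x"
proof -
  obtain T c where "finite T" "T \<subseteq> {outer_square x | x :: real^'n. \<forall>i. 0 \<le> x $ i}"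
    "\<forall>Y\<in>T. 0 \<le> c Y" "X = (\<Sum>Y\<in>T. c Y *\<^sub>R Y)"
    using assms unfolding completely_positive_cone_def by (rule conic_combinationsE)
  then show ?thesis
    by (intro that[of T c]) blast+
qed

text \<open>The dual cone of the completely positive cone. Symmetry is not built in, since the form
  sees only the symmetric part of \<open>A\<close>; where it matters it is assumed
  separately.\<close>

definition copositive :: "real^'n^'n \<Rightarrow> bool" where
  "copositive A \<longleftrightarrow> (\<forall>x. (\<forall>i. 0 \<le> x $ i) \<longrightarrow> 0 \<le> x \<bullet> (A *v x))"

lemma copositive_outer_square: "copositive (outer_square w)"
  by (simp add: copositive_def flip: inner_outer_square) (simp add: inner_outer_squares)

lemma copositive_inner_nonneg:
  assumes "copositive A" "X \<in> completely_positive_cone"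
  shows "0 \<le> A \<bullet> X"
  using assms(2)
proof (cases rule: completely_positive_coneE)
  case (1 T c)
  have "0 \<le> A \<bullet> Y" if "Y \<in> T" for Y
    using 1(4)[OF that] assms(1) by (auto simp: copositive_def inner_outer_square)
  then show ?thesis
    using 1(2) by (auto simp: 1(3) inner_sum_right intro!: sum_nonneg)
qed

definition exposed :: "real^'n^'n \<Rightarrow> (real^'n^'n) set" where
  "exposed A = {X \<in> completely_positive_cone. A \<bullet> X = 0}"

lemma exposed_face_of:
  assumes "copositive A"
  shows "exposed A face_of completely_positive_cone"
proof -
  have "exposed A = completely_positive_cone \<inter> {X. A \<bullet> X = 0}"
    by (auto simp: exposed_def)
  then show ?thesis
    using face_of_Int_supporting_hyperplane_ge[OF convex_completely_positive_cone
        copositive_inner_nonneg[OF assms]] by simp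
qed

lemma zero_in_exposed: "0 \<in> exposed A"
  by (simp add: exposed_def zero_in_cone)

text \<open>A nonzero \<open>X\<close> in the face is the midpoint of \<open>0\<close> and
  \<open>2 *\<^sub>R X\<close>, both in the cone.\<close>

lemma zero_in_face:
  assumes F: "F face_of completely_positive_cone" and "F \<noteq> {}"
  shows "0 \<in> F"
proof -
  obtain X where X: "X \<in> F"
    using assms by blast
  then have XK: "X \<in> completely_positive_cone"
    using F face_of_imp_subset by blast
  show ?thesis
  proof (cases "X = 0")
    case False
    have "X \<in> open_segment 0 (2 *\<^sub>R X)"
      unfolding in_segment using False by (auto intro!: exI[of _ "1/2"])
    then show ?thesis
      using F X XK zero_in_cone scale_in_cone[OF XK, of 2] unfolding face_of_def by auto
  qed (use X in simp)
qed

text \<open>The sum is the midpoint of \<open>2 *\<^sub>R A\<close> and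
  \<open>2 *\<^sub>R B\<close>, and halving stays in the face because \<open>0\<close> belongs to
  it. Equal summands are treated apart, as their open segment is empty.\<close>

lemma face_summand:
  assumes F: "F face_of completely_positive_cone"
    and A: "A \<in> completely_positive_cone" and B: "B \<in> completely_positive_cone"
    and AB: "A + B \<in> F"
  shows "A \<in> F"
proof -
  have 0: "0 \<in> F"
    using F AB zero_in_face by blast
  have half: "X \<in> F" if "2 *\<^sub>R X \<in> F" for X
    using convexD[OF face_of_imp_convex[OF F] that 0, of "1/2" "1/2"] by simp
  show ?thesis
  proof (cases "A = B")
    case True
    then show ?thesis
      using half AB by (simp add: scaleR_2)
  next
    case False
    have "A + B \<in> open_segment (2 *\<^sub>R A) (2 *\<^sub>R B)"
      unfolding in_segment using False by (auto intro!: exI[of _ "1/2"])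
    then have "2 *\<^sub>R A \<in> F"
      using F AB scale_in_cone[OF A, of 2] scale_in_cone[OF B, of 2] unfolding face_of_def by auto
    then show ?thesis
      by (rule half)
  qed
qed

text \<open>The point \<open>c *\<^sub>R Y\<close> lies strictly between \<open>0\<close> and
  \<open>(1 + c) *\<^sub>R Y\<close>, and the latter splits into \<open>Y\<close> and
  \<open>c *\<^sub>R Y\<close>. This covers factors below and above 1 at once.\<close>

lemma face_unscale:
  assumes F: "F face_of completely_positive_cone"
    and Y: "Y \<in> completely_positive_cone" and c: "0 < c" "c *\<^sub>R Y \<in> F"
  shows "Y \<in> F"
proof (cases "Y = 0")
  case True
  then show ?thesis
    using F c zero_in_face by blast
next
  case False
  have "(1 + c) *\<^sub>R Y \<noteq> 0" "c / (1 + c) * (1 + c) = c"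
    using False c(1) by simp_all
  then have "c *\<^sub>R Y \<in> open_segment 0 ((1 + c) *\<^sub>R Y)"
    unfolding in_segment scaleR_scaleR using c(1) by (auto intro!: exI[of _ "c / (1 + c)"])
  then have "(1 + c) *\<^sub>R Y \<in> F"
    using F c zero_in_cone scale_in_cone[OF Y, of "1 + c"] unfolding face_of_def by auto
  then show ?thesis
    using face_summand[OF F Y scale_in_cone[OF Y, of c]] c(1) by (simp add: scaleR_add_left)
qed

section \<open>Linear independence of rank-one squares\<close>

lemma independent_dual_vector:
  fixes b :: "'a::euclidean_space"
  assumes "independent B" "b \<in> B"
  obtains v where "v \<bullet> b \<noteq> 0" "\<And>c. c \<in> B \<Longrightarrow> c \<noteq> b \<Longrightarrow> v \<bullet> c = 0"
proof -
  have "b \<notin> span (B - {b})"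
    using assms dependent_def by blast
  then have "span (B - {b}) \<subset> span (insert b (B - {b}))"
    using span_mono[of "B - {b}" "insert b (B - {b})"] span_base[of b "insert b (B - {b})"] by blast
  \<comment> \<open>\<open>v\<close> is a direction inside the full span orthogonal to the other
    vectors; were it also orthogonal to \<open>b\<close>, it would be orthogonal to itself.\<close>
  then obtain v where v: "v \<noteq> 0" "v \<in> span (insert b (B - {b}))"
      "\<And>y. y \<in> span (B - {b}) \<Longrightarrow> orthogonal v y"
    using orthogonal_to_subspace_exists_gen by metis
  have "v \<bullet> b \<noteq> 0"
  proof
    assume "v \<bullet> b = 0"
    then have "orthogonal v y" if "y \<in> insert b (B - {b})" for y
      using that v(3)[OF span_base, of y] by (auto simp: orthogonal_def)
    then have "orthogonal v v"
      using v(2) orthogonal_to_span by blast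
    then show False
      using v(1) by (simp add: orthogonal_self)
  qed
  moreover have "v \<bullet> c = 0" if "c \<in> B" "c \<noteq> b" for c
    using that v(3)[of c] by (simp add: orthogonal_def span_base)
  ultimately show thesis
    by (rule that)
qed

lemma inner_matrix_zero_on_span:
  fixes X :: "real^'n^'m"
  assumes "\<And>X. X \<in> S \<Longrightarrow> v \<bullet> (X *v w) = 0" "X \<in> span S"
  shows "v \<bullet> (X *v w) = 0"
  using assms(2)
proof (induction rule: span_induct_alt)
  case (step c X Y)
  then show ?case
    by (simp add: assms(1) matrix_vector_mult_add_rdistrib inner_add_right
        scaleR_matrix_vector_assoc[symmetric] del: scaleR_matrix_vector_assoc)
qed simp

text \<open>With \<open>v\<close> dual to \<open>b\<close>, the linear functional sending
  \<open>X\<close> to \<open>v \<bullet> (X *v v)\<close> kills the other squares but not that of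
  \<open>b\<close>.\<close>

lemma outer_square_notin_span:
  assumes "independent B" "b \<in> B"
  shows "outer_square b \<notin> span (outer_square ` (B - {b}))"
proof
  assume span: "outer_square b \<in> span (outer_square ` (B - {b}))"
  obtain v where v: "v \<bullet> b \<noteq> 0" "\<And>c. c \<in> B \<Longrightarrow> c \<noteq> b \<Longrightarrow> v \<bullet> c = 0"
    using independent_dual_vector[OF assms] by blast
  have "v \<bullet> (outer_square b *v v) = 0"
    by (rule inner_matrix_zero_on_span[OF _ span]) (auto simp: outer_square_vector_mult dest: v(2))
  then show False
    using v(1) by (simp add: outer_square_vector_mult inner_commute)
qed

lemma independent_outer_squares:
  assumes "independent B"
  shows "independent (outer_square ` B)"
  unfolding dependent_def
proof safe
  fix b assume "b \<in> B" "outer_square b \<in> span (outer_square ` B - {outer_square b})"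
  moreover have "outer_square ` B - {outer_square b} \<subseteq> outer_square ` (B - {b})"
    by auto
  ultimately show False
    using outer_square_notin_span[OF assms] span_mono by blast
qed

lemma inj_on_outer_square:
  assumes "independent B"
  shows "inj_on outer_square B"
proof (rule inj_onI, rule ccontr)
  fix b c assume *: "b \<in> B" "c \<in> B" "outer_square b = outer_square c" "b \<noteq> c"
  then have "outer_square b \<in> span (outer_square ` (B - {b}))"
    by (auto intro: span_base)
  then show False
    using outer_square_notin_span[OF assms] * by blast
qed

text \<open>The mixed functional sending \<open>X\<close> to \<open>v \<bullet> (X *v w)\<close>,
  with \<open>v\<close> dual to \<open>b\<close> and \<open>w\<close> dual to \<open>c\<close>,
  kills every square from \<open>B\<close> but sees the cross term of \<open>b + c\<close>.\<close>

lemma outer_square_add_notin_span: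
  assumes B: "independent B" and b: "b \<in> B" "c \<in> B" "b \<noteq> c"
  shows "outer_square (b + c) \<notin> span (outer_square ` B)"
proof
  assume span: "outer_square (b + c) \<in> span (outer_square ` B)"
  obtain v where v: "v \<bullet> b \<noteq> 0" "\<And>a. a \<in> B \<Longrightarrow> a \<noteq> b \<Longrightarrow> v \<bullet> a = 0"
    using independent_dual_vector[OF B b(1)] by blast
  obtain w where w: "w \<bullet> c \<noteq> 0" "\<And>a. a \<in> B \<Longrightarrow> a \<noteq> c \<Longrightarrow> w \<bullet> a = 0"
    using independent_dual_vector[OF B b(2)] by blast
  have "v \<bullet> (outer_square a *v w) = 0" if "a \<in> B" for a
    using that b v(2)[of a] w(2)[of b]
    by (cases "a = b") (auto simp: outer_square_vector_mult inner_commute[of _ w])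
  then have "v \<bullet> (outer_square (b + c) *v w) = 0"
    by (intro inner_matrix_zero_on_span[OF _ span]) auto
  then show False
    using v w b
    by (simp add: outer_square_vector_mult inner_commute[of _ w] inner_add_right)
qed

section \<open>Lower bound on the dimension of maximal faces\<close>

lemma aff_dim_maximal_face_ge:
  fixes F :: "(real^'n^'n) set"
  assumes F: "maximal_face_of F completely_positive_cone" and n: "CARD('n) \<ge> 3"
  shows "int CARD('n) \<le> aff_dim F"
proof (rule ccontr)
  assume less: "\<not> int CARD('n) \<le> aff_dim F"
  have face: "F face_of completely_positive_cone" and ne: "F \<noteq> {}"
    using F by (auto simp: maximal_face_of_def)
  have dimF: "dim F < CARD('n)"
    using less aff_dim_zero[of F] zero_in_face[OF face ne] by (simp add: hull_inc)
  define Z where "Z = {x :: real^'n. (\<forall>i. 0 \<le> x $ i) \<and> outer_square x \<in> F}"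
  have no_indep: "card T < CARD('n)" if "independent T" "T \<subseteq> F" for T
    using independent_card_le_dim[OF that(2,1)] dimF by simp
  obtain B where B: "B \<subseteq> Z" "independent B" "Z \<subseteq> span B" "card B = dim Z"
    using basis_exists by blast
  have outer_B: "outer_square ` B \<subseteq> F"
    using B(1) by (auto simp: Z_def)
  have dimZ: "dim Z < CARD('n)"
    using no_indep[OF independent_outer_squares[OF B(2)] outer_B]
    by (simp add: B(4) card_image inj_on_outer_square B(2))
  then have "dim Z < DIM(real^'n)"
    by simp
  then obtain w where w: "w \<noteq> 0" "\<And>x. x \<in> span Z \<Longrightarrow> orthogonal w x"
    using orthogonal_to_subspace_exists by metis
  text \<open>The case distinction makes the nonnegative part of the hyperplane span it: if \<open>w\<close> has
    no two entries of opposite sign, then a coordinate hyperplane contains \<open>Z\<close>.\<close>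
  obtain v y where v: "v \<noteq> 0" "\<And>x. x \<in> Z \<Longrightarrow> v \<bullet> x = 0"
    and y: "\<And>i. 0 \<le> y $ i" "v \<bullet> y = 0"
      "\<And>i x. y $ i = 0 \<Longrightarrow> v \<bullet> x = 0 \<Longrightarrow> x $ i = 0"
  proof (cases "\<exists>p q. w $ p > 0 \<and> w $ q < 0")
    case True
    then obtain p q where pq: "w $ p > 0" "w $ q < 0"
      by blast
    \<comment> \<open>\<open>r\<close> is chosen so that moving the all-ones vector onto the
      hyperplane of \<open>w\<close> along coordinate \<open>r\<close> needs a nonnegative shift,
      which keeps all entries positive.\<close>
    define r where "r = (if w \<bullet> 1 \<ge> 0 then q else p)"
    have r: "w $ r \<noteq> 0" "0 \<le> - (w \<bullet> 1) / w $ r"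
      using pq by (auto simp: r_def divide_simps)
    define y where "y = 1 + axis r (- (w \<bullet> 1) / w $ r)"
    have pos: "0 < y $ i" for i
      using r(2) by (auto simp: y_def axis_def intro: add_pos_nonneg)
    moreover have "w \<bullet> y = 0"
      using r(1) by (simp add: y_def inner_add_right inner_axis)
    moreover have "w \<bullet> x = 0" if "x \<in> Z" for x
      using w(2)[of x] that by (simp add: span_base orthogonal_def)
    ultimately show thesis
      using w(1) by (intro that[of w y]) (auto simp: less_imp_le less_imp_neq[OF pos, symmetric])
  next
    case False
    obtain p where p: "w $ p \<noteq> 0"
      using w(1) by (metis vec_eq_iff zero_index)
    have "axis p 1 \<bullet> x = 0" if x: "x \<in> Z" for x
    proof -
      have "(\<Sum>i\<in>UNIV. w $ i * x $ i) = 0"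
        using w(2)[of x] x by (simp add: span_base orthogonal_def inner_vec_def)
      \<comment> \<open>All terms of the vanishing sum have the same sign, so each of them is zero;
        at \<open>p\<close> this forces \<open>x $ p = 0\<close>.\<close>
      moreover have "(\<forall>i. 0 \<le> w $ i) \<or> (\<forall>i. 0 \<le> - w $ i)"
        using False by (meson neg_0_le_iff_le not_le)
      ultimately have "(\<Sum>i\<in>UNIV. \<bar>w $ i * x $ i\<bar>) = 0"
      proof (elim disjE)
        assume "\<forall>i. 0 \<le> w $ i"
        then have "\<bar>w $ i * x $ i\<bar> = w $ i * x $ i" for i
          using x by (simp add: Z_def)
        then show ?thesis
          using \<open>(\<Sum>i\<in>UNIV. w $ i * x $ i) = 0\<close> by simp
      next
        assume "\<forall>i. 0 \<le> - w $ i"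
        then have "\<bar>w $ i * x $ i\<bar> = - (w $ i * x $ i)" for i
          using x by (intro abs_of_nonpos mult_nonpos_nonneg) (simp_all add: Z_def)
        then show ?thesis
          using \<open>(\<Sum>i\<in>UNIV. w $ i * x $ i) = 0\<close> by (simp add: sum_negf)
      qed
      then have "w $ p * x $ p = 0"
        by (simp add: sum_nonneg_eq_0_iff)
      then show ?thesis
        using p by (simp add: inner_axis')
    qed
    moreover have "0 \<le> (1 - axis p 1 :: real^'n) $ i" for i
      by (simp add: axis_def)
    moreover have "axis p 1 \<bullet> (1 - axis p 1 :: real^'n) = 0"
      by (simp add: inner_axis')
    moreover have "x $ i = 0" if "(1 - axis p 1 :: real^'n) $ i = 0" "axis p 1 \<bullet> x = 0"
      for i and x :: "real^'n"
      using that by (cases "i = p") (simp_all add: inner_axis', simp add: axis_def)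
    ultimately show thesis
      by (intro that[of "axis p 1" "1 - axis p 1"]) auto
  qed
  have "F = exposed (outer_square v)"
  proof -
    \<comment> \<open>Every term with positive coefficient in a decomposition of \<open>X\<close>
      lies in \<open>F\<close>, hence is the square of a vector of \<open>Z\<close>, which is
      orthogonal to \<open>v\<close>. Maximality then turns the inclusion into equality.\<close>
    have "F \<subseteq> exposed (outer_square v)"
    proof
      fix X assume X: "X \<in> F"
      then have XK: "X \<in> completely_positive_cone"
        using face face_of_imp_subset by blast
      show "X \<in> exposed (outer_square v)"
        using XK
      proof (cases rule: completely_positive_coneE)
        case (1 T c)
        have "c Y * (outer_square v \<bullet> Y) = 0" if Y: "Y \<in> T" for Y
        proof (cases "c Y = 0")
          case False
          obtain x where x: "\<And>i. 0 \<le> x $ i" "Y = outer_square x"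
            using 1(4)[OF Y] by blast
          have YK: "Y' \<in> completely_positive_cone" if "Y' \<in> T" for Y'
            using 1(4)[OF that] outer_square_in_cone by blast
          have "(\<Sum>Y\<in>U. c Y *\<^sub>R Y) \<in> completely_positive_cone" if "U \<subseteq> T" for U
            using finite_subset[OF that 1(1)] that
          proof (induction U rule: finite_induct)
            case (insert Y' U)
            then show ?case
              using 1(2) scale_in_cone[OF YK]
              by (auto simp: completely_positive_cone_def intro!: conic_combinations_add)
          qed (simp add: zero_in_cone)
          then have "c Y *\<^sub>R Y \<in> F"
            using face_summand[OF face, of "c Y *\<^sub>R Y" "\<Sum>Y\<in>T - {Y}. c Y *\<^sub>R Y"]
              1 X Y scale_in_cone[OF YK[OF Y]] by (simp add: sum.remove[OF 1(1) Y])
          then have "Y \<in> F"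
            using face_unscale[OF face YK[OF Y], of "c Y"] 1(2) Y False by (simp add: less_le)
          then show ?thesis
            using v(2)[of x] x by (simp add: Z_def inner_outer_squares)
        qed simp
        then show ?thesis
          using XK unfolding exposed_def by (simp add: 1(3) inner_sum_right sum.neutral)
      qed
    qed
    moreover have "exposed (outer_square v) \<noteq> completely_positive_cone"
    proof -
      obtain p where p: "v $ p \<noteq> 0"
        using v(1) by (metis vec_eq_iff zero_index)
      have "outer_square (axis p 1 :: real^'n) \<in> completely_positive_cone"
        by (intro outer_square_in_cone) (simp add: axis_def)
      moreover have "outer_square (axis p 1) \<notin> exposed (outer_square v)"
        using p by (simp add: exposed_def inner_outer_squares inner_axis)
      ultimately show ?thesis
        by blast
    qed
    ultimately show ?thesis
      using F exposed_face_of[OF copositive_outer_square[of v]] zero_in_exposed[of "outer_square v"]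
      unfolding maximal_face_of_def by blast
  qed
  then have Z: "Z = {x. (\<forall>i. 0 \<le> x $ i) \<and> v \<bullet> x = 0}"
    by (auto simp: Z_def exposed_def inner_outer_squares outer_square_in_cone)
  have "{x. v \<bullet> x = 0} \<subseteq> span Z"
  proof
    fix x assume "x \<in> {x. v \<bullet> x = 0}"
    then have x: "v \<bullet> x = 0"
      by simp
    \<comment> \<open>A large multiple of \<open>y\<close> makes \<open>x\<close> nonnegative, so
      \<open>x\<close> is a difference of two elements of \<open>Z\<close>. Where
      \<open>y $ i = 0\<close> the quotient is 0 by convention, which is harmless because
      \<open>x $ i = 0\<close> there.\<close>
    define N where "N = (\<Sum>i\<in>UNIV. \<bar>x $ i\<bar> / y $ i)"
    have N: "\<bar>x $ i\<bar> \<le> N * y $ i" for i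
    proof (cases "y $ i = 0")
      case True
      then show ?thesis
        using y(3) x by simp
    next
      case False
      have "\<bar>x $ i\<bar> / y $ i \<le> N"
        unfolding N_def by (rule member_le_sum) (auto simp: y(1))
      then show ?thesis
        using False y(1)[of i] by (simp add: divide_simps split: if_splits)
    qed
    have "0 \<le> N"
      by (simp add: N_def sum_nonneg y(1))
    then have "N *\<^sub>R y \<in> Z"
      by (simp add: Z y)
    moreover have "0 \<le> N * y $ i + x $ i" for i
      using N[of i] by linarith
    then have "N *\<^sub>R y + x \<in> Z"
      by (simp add: Z y x inner_add_right)
    ultimately have "(N *\<^sub>R y + x) - N *\<^sub>R y \<in> span Z"
      by (intro span_diff span_base)
    then show "x \<in> span Z"
      by simp
  qed
  then have "CARD('n) - 1 \<le> card B"
    using dim_subset[of "{x. v \<bullet> x = 0}" "span Z"] dim_hyperplane[OF v(1)] by (simp add: B(4))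
  \<comment> \<open>The basis has at least \<open>CARD('n) - 1\<close> elements, hence at least two
    once \<open>CARD('n)\<close> is at least 3.\<close>
  then obtain b c where bc: "b \<in> B" "c \<in> B" "b \<noteq> c"
    using n card_le_Suc0_iff_eq[of B] independent_imp_finite[OF B(2)] by fastforce
  have "b + c \<in> Z"
    using subsetD[OF B(1) bc(1)] subsetD[OF B(1) bc(2)] by (simp add: Z inner_add_right)
  then have "insert (outer_square (b + c)) (outer_square ` B) \<subseteq> F"
    using outer_B by (auto simp: Z_def)
  moreover have notin: "outer_square (b + c) \<notin> span (outer_square ` B)"
    using outer_square_add_notin_span[OF B(2) bc] .
  ultimately have "card (insert (outer_square (b + c)) (outer_square ` B)) < CARD('n)"
    by (intro no_indep) (simp_all add: independent_insert independent_outer_squares B(2))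
  moreover have "outer_square (b + c) \<notin> outer_square ` B"
    using notin span_superset[of "outer_square ` B"] by blast
  ultimately show False
    using \<open>CARD('n) - 1 \<le> card B\<close> n independent_imp_finite[OF B(2)]
    by (simp add: card_image inj_on_outer_square B(2))
qed

section \<open>Supporting hyperplanes and first-order conditions\<close>

lemma inner_transpose: "transpose A \<bullet> X = A \<bullet> transpose X" for A :: "real^'m^'n"
  unfolding inner_vec_def transpose_def by (simp, subst sum.swap, simp)

lemma transpose_completely_positive:
  fixes X :: "real^'n^'n"
  assumes "X \<in> completely_positive_cone"
  shows "transpose X = X"
  using assms
proof (cases rule: completely_positive_coneE)
  case (1 T c)
  have "Y $ j $ i = Y $ i $ j" if "Y \<in> T" for Y i j
    using 1(4)[OF that] by auto
  then show ?thesis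
    by (simp add: 1(3) transpose_def vec_eq_iff)
qed

text \<open>Completely positive matrices are symmetric, so the antisymmetric part of
  \<open>B\<close> is orthogonal to them.\<close>

lemma inner_symmetrize:
  fixes X :: "real^'n^'n"
  assumes "X \<in> completely_positive_cone"
  shows "((1/2) *\<^sub>R (B + transpose B)) \<bullet> X = B \<bullet> X"
  using transpose_completely_positive[OF assms] by (simp add: inner_add_left inner_transpose)

text \<open>Exposed faces suffice to test maximality: a proper face lies in the boundary of the cone and
  hence in a supporting hyperplane, whose normal can be taken symmetric.\<close>

lemma proper_face_in_exposed:
  fixes F :: "(real^'n^'n) set"
  assumes F: "F face_of completely_positive_cone" "F \<noteq> {}" "F \<noteq> completely_positive_cone"
  obtains B where "transpose B = B" "copositive B" "B \<noteq> 0" "F \<subseteq> exposed B"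
proof -
  let ?K = "completely_positive_cone :: (real^'n^'n) set"
  have FK: "F \<subseteq> ?K"
    using F(1) by (rule face_of_imp_subset)
  have conv: "convex F"
    using F(1) by (rule face_of_imp_convex)
  obtain X where X: "X \<in> rel_interior F"
    using rel_interior_eq_empty[OF conv] F(2) by blast
  have XF: "X \<in> F"
    using X rel_interior_subset by blast
  then have XK: "X \<in> ?K"
    using FK by blast
  have "X \<notin> rel_interior ?K"
    using face_of_disjoint_rel_interior[OF F(1,3)] XF by blast
  then obtain H where H: "\<And>Y. Y \<in> ?K \<Longrightarrow> H \<bullet> X \<le> H \<bullet> Y"
      "\<And>Y. Y \<in> rel_interior ?K \<Longrightarrow> H \<bullet> X < H \<bullet> Y"
    using supporting_hyperplane_rel_boundary[OF convex_completely_positive_cone XK] by metis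
  \<comment> \<open>On a cone, a minimal value attained at \<open>X\<close> must be 0: compare
    \<open>X\<close> with \<open>0\<close> and with \<open>2 *\<^sub>R X\<close>.\<close>
  have HX: "H \<bullet> X = 0"
    using H(1)[OF zero_in_cone] H(1)[OF scale_in_cone[OF XK, of 2]] by simp
  define B where "B = (1/2) *\<^sub>R (H + transpose H)"
  have BH: "B \<bullet> Y = H \<bullet> Y" if "Y \<in> ?K" for Y
    unfolding B_def using that by (rule inner_symmetrize)
  show thesis
  proof
    show "transpose B = B"
      by (simp add: B_def transpose_def vec_eq_iff add.commute)
    show "copositive B"
      unfolding copositive_def
    proof (intro allI impI)
      fix x :: "real^'n" assume "\<forall>i. 0 \<le> x $ i"
      then have "outer_square x \<in> ?K"
        by (intro outer_square_in_cone) simp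
      then show "0 \<le> x \<bullet> (B *v x)"
        using H(1) by (simp add: BH HX flip: inner_outer_square)
    qed
    obtain Y where Y: "Y \<in> rel_interior ?K"
      using rel_interior_eq_empty[OF convex_completely_positive_cone] zero_in_cone by blast
    then have "B \<bullet> Y > 0"
      using H(2)[OF Y] BH[of Y] HX subsetD[OF rel_interior_subset Y] by simp
    then show "B \<noteq> 0"
      by auto
    show "F \<subseteq> exposed B"
    proof
      fix Y assume Y: "Y \<in> F"
      \<comment> \<open>From a relative interior point the segment from \<open>Y\<close> can be
        prolonged beyond \<open>X\<close> inside \<open>F\<close>. As \<open>H\<close> vanishes at
        \<open>X\<close>, a positive value at \<open>Y\<close> would become negative on the other
        side.\<close>
      obtain e where e: "e > 1" "(1 - e) *\<^sub>R Y + e *\<^sub>R X \<in> F"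
        using convex_rel_interior_iff[OF conv F(2), of X] X Y by blast
      then have "0 \<le> (1 - e) * (H \<bullet> Y)"
        using H(1)[of "(1 - e) *\<^sub>R Y + e *\<^sub>R X"] FK by (auto simp: inner_add_right HX)
      then have "H \<bullet> Y \<le> 0"
        using e(1) by (simp add: zero_le_mult_iff)
      moreover have "0 \<le> H \<bullet> Y"
        using H(1)[of Y] Y FK HX by auto
      ultimately show "Y \<in> exposed B"
        using Y FK BH[of Y] by (auto simp: exposed_def)
    qed
  qed
qed

text \<open>\<open>x\<close> minimizes the form over the nonnegative orthant; these are the
  first-order conditions and complementary slackness there.\<close>

lemma copositive_zero:
  fixes M :: "real^'n^'n"
  assumes sym: "transpose M = M" and M: "copositive M"
    and x: "\<And>i. 0 \<le> x $ i" "x \<bullet> (M *v x) = 0"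
  shows "0 \<le> (M *v x) $ i" and "0 < x $ i \<Longrightarrow> (M *v x) $ i = 0"
proof -
  have nonneg: "0 \<le> (M *v x) $ i" for i
  proof (rule ccontr)
    assume "\<not> 0 \<le> (M *v x) $ i"
    \<comment> \<open>Moving \<open>x\<close> by \<open>t\<close> along axis \<open>i\<close>
      changes the form by \<open>t * (t * M $ i $ i - 2 * g)\<close>. Since \<open>m\<close> is
      positive and exceeds the diagonal entry, \<open>t = g / m\<close> makes this negative.\<close>
    define g m where "g = - (M *v x) $ i" and "m = \<bar>M $ i $ i\<bar> + 1"
    have g: "0 < g" and m: "0 < m" "M $ i $ i < m"
      using \<open>\<not> 0 \<le> (M *v x) $ i\<close> by (auto simp: g_def m_def)
    define t where "t = g / m"
    have t: "0 < t"
      using g m by (simp add: t_def)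
    have ax: "axis i 1 \<bullet> (M *v y) = (M *v y) $ i" for y
      by (simp add: inner_axis')
    have cross: "x \<bullet> (M *v axis i 1) = (M *v x) $ i"
      using dot_lmul_matrix[of x M "axis i 1"] sym
      by (simp add: vector_transpose_matrix inner_axis flip: transpose_matrix_vector)
    have diag: "(M *v axis i 1) $ i = M $ i $ i"
      by (simp add: matrix_vector_mult_basis column_def)
    have "0 \<le> (x + t *\<^sub>R axis i 1) \<bullet> (M *v (x + t *\<^sub>R axis i 1))"
      using M x(1) t unfolding copositive_def by (auto simp: axis_def)
    also have "\<dots> = t * (t * M $ i $ i - 2 * g)"
      by (simp add: matrix_vector_right_distrib matrix_vector_mult_scaleR inner_add_left
          inner_add_right x(2) ax cross diag g_def algebra_simps power2_eq_square)
    finally have "2 * g \<le> t * M $ i $ i"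
      using t by (simp add: zero_le_mult_iff)
    also have "\<dots> \<le> t * m"
      using t m by (intro mult_left_mono) auto
    also have "\<dots> = g"
      using m by (simp add: t_def)
    finally show False
      using g by simp
  qed
  then show "0 \<le> (M *v x) $ i" .
  have "(\<Sum>i\<in>UNIV. x $ i * (M *v x) $ i) = 0"
    using x(2) by (simp add: inner_vec_def)
  then have "x $ i * (M *v x) $ i = 0"
    using nonneg x(1) by (subst (asm) sum_nonneg_eq_0_iff) auto
  then show "0 < x $ i \<Longrightarrow> (M *v x) $ i = 0"
    by simp
qed

section \<open>Angles and trigonometric sums on the regular polygon\<close>

lemma cos_le_cos:
  assumes "0 \<le> d" "d \<le> t" "t \<le> 2 * pi - d"
  shows "cos t \<le> cos d"
proof (cases "t \<le> pi")
  case True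
  then show ?thesis
    using assms by (intro cos_monotone_0_pi_le) auto
next
  case False
  then have "cos (2 * pi - t) \<le> cos d"
    using assms by (intro cos_monotone_0_pi_le) auto
  then show ?thesis
    by simp
qed

text \<open>The index type carries no order, so a position function identifies it with the vertices of
  a regular polygon inscribed in the unit circle.\<close>

locale cyclic_indexing =
  fixes pos :: "'n::finite \<Rightarrow> nat"
  assumes bij_pos: "bij_betw pos UNIV {..<CARD('n)}"
    and odd_card: "odd CARD('n)" and card_ge: "CARD('n) \<ge> 5"
begin

definition vertex :: "nat \<Rightarrow> 'n" where
  "vertex m = inv_into UNIV pos (m mod CARD('n))"

definition S :: "'n \<Rightarrow> 'n" where
  "S i = vertex (Suc (pos i))"

text \<open>Half the angle between neighbouring vertices, so the edge from \<open>k\<close> to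
  \<open>S k\<close> has its midpoint in direction \<open>\<theta> k + d\<close>.\<close>

definition d :: real where
  "d = pi / real CARD('n)"

definition \<theta> :: "'n \<Rightarrow> real" where
  "\<theta> i = 2 * d * real (pos i)"

lemma pos_less: "pos i < CARD('n)"
  using bij_pos by (auto simp: bij_betw_def)

lemma pos_vertex: "pos (vertex m) = m mod CARD('n)"
  unfolding vertex_def using bij_pos by (intro f_inv_into_f) (auto simp: bij_betw_def)

lemma pos_inject: "pos i = pos j \<longleftrightarrow> i = j"
  using bij_pos by (auto simp: bij_betw_def inj_on_def)

lemma vertex_pos: "vertex (pos i) = i"
  by (simp add: pos_vertex pos_less flip: pos_inject)

lemma S_vertex: "S (vertex m) = vertex (Suc m)"
  by (simp add: S_def pos_vertex mod_Suc_eq flip: pos_inject)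

lemma surj_S: "\<exists>j. i = S j"
proof
  show "i = S (vertex (pos i + (CARD('n) - 1)))"
    by (simp add: S_vertex pos_vertex pos_less flip: pos_inject)
qed

lemma bij_S: "bij S"
  using surj_S by (simp add: bij_betw_def finite_UNIV_surj_inj surj_def)

lemma S_distinct:
  "S i \<noteq> i" "S (S i) \<noteq> i" "S (S (S i)) \<noteq> i" "S (S (S (S i))) \<noteq> i"
proof -
  have *: "vertex (pos i + m) \<noteq> i" if "0 < m" "m < CARD('n)" for m
  proof
    assume "vertex (pos i + m) = i"
    then have "(pos i + m) mod CARD('n) = pos i"
      by (metis pos_vertex)
    then show False
      using that pos_less[of i] by (cases "pos i + m < CARD('n)") (auto simp: le_mod_geq)
  qed
  have "S i = vertex (pos i + 1)" "S (S i) = vertex (pos i + 2)" "S (S (S i)) = vertex (pos i + 3)"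
    "S (S (S (S i))) = vertex (pos i + 4)"
    by (simp_all add: S_def[of i] S_vertex numeral_eq_Suc)
  then show "S i \<noteq> i" "S (S i) \<noteq> i" "S (S (S i)) \<noteq> i" "S (S (S (S i))) \<noteq> i"
    using *[of 1] *[of 2] *[of 3] *[of 4] card_ge by auto
qed

lemma S_inject [simp]: "S i = S j \<longleftrightarrow> i = j"
  using bij_S by (auto simp: bij_def inj_def)

lemma const_of_S_invariant:
  assumes "\<And>i. f (S i) = f i"
  shows "f i = f j"
proof -
  have "f (vertex m) = f (vertex 0)" for m
    by (induction m) (simp_all add: assms flip: S_vertex)
  then show ?thesis
    by (metis vertex_pos)
qed

text \<open>One turn around the polygon flips the sign an odd number of times; this is where oddness
  enters.\<close>

lemma zero_of_S_alternating:
  fixes z :: "'n \<Rightarrow> real"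
  assumes "\<And>i. z i + z (S i) = 0"
  shows "z i = 0"
proof -
  have z: "z (S i) = - z i" for i
    using assms[of i] by linarith
  have alt: "z (vertex m) = (- 1) ^ m * z (vertex 0)" for m
    by (induction m) (simp_all add: z flip: S_vertex)
  have "vertex CARD('n) = vertex 0"
    by (simp add: vertex_def)
  then have "z (vertex 0) = 0"
    using alt[of "CARD('n)"] odd_card by simp
  then show ?thesis
    using alt[of "pos i"] by (simp add: vertex_pos)
qed

lemma n_d: "real CARD('n) * d = pi"
  by (simp add: d_def)

lemma d_pos: "0 < d"
  by (simp add: d_def)

lemma d_le: "5 * d \<le> pi"
proof -
  have "5 * d \<le> real CARD('n) * d"
    using card_ge d_pos by (intro mult_right_mono) auto
  then show ?thesis
    by (simp add: n_d)
qed

lemma theta_S: "\<theta> (S i) = \<theta> i + 2 * d \<or> \<theta> (S i) = \<theta> i + 2 * d - 2 * pi"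
proof (cases "Suc (pos i) < CARD('n)")
  case True
  then show ?thesis
    by (simp add: \<theta>_def S_def pos_vertex algebra_simps)
next
  case False
  then have "Suc (pos i) = CARD('n)"
    using pos_less[of i] by simp
  then have "2 * d * (real (pos i) + 1) = 2 * pi" "pos (S i) = 0"
    using n_d by (simp_all add: S_def pos_vertex algebra_simps flip: of_nat_Suc)
  then show ?thesis
    by (simp add: \<theta>_def algebra_simps)
qed

lemma cos_theta_S: "cos (\<theta> (S i) + t) = cos (\<theta> i + 2 * d + t)"
proof (cases "\<theta> (S i) = \<theta> i + 2 * d")
  case False
  then have "\<theta> i + 2 * d + t = \<theta> (S i) + t + 2 * pi"
    using theta_S[of i] by simp
  then show ?thesis
    by (simp only: cos_periodic)
qed simp

lemma sin_theta_S: "sin (\<theta> (S i) + t) = sin (\<theta> i + 2 * d + t)"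
proof (cases "\<theta> (S i) = \<theta> i + 2 * d")
  case False
  then have "\<theta> i + 2 * d + t = \<theta> (S i) + t + 2 * pi"
    using theta_S[of i] by simp
  then show ?thesis
    by (simp only: sin_periodic)
qed simp

lemma cos_theta_diff_le:
  assumes "i \<noteq> j"
  shows "cos (\<theta> i - \<theta> j) \<le> cos (2 * d)"
proof -
  have *: "cos (\<theta> i - \<theta> j) \<le> cos (2 * d)" if "pos j < pos i" for i j
  proof (rule cos_le_cos)
    have "2 * d * 1 \<le> 2 * d * (real (pos i) - real (pos j))"
      using that d_pos by (intro mult_left_mono) auto
    then show "2 * d \<le> \<theta> i - \<theta> j"
      by (simp add: \<theta>_def algebra_simps)
    have "2 * d * (real (pos i) - real (pos j)) \<le> 2 * d * (real CARD('n) - 1)"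
      using pos_less[of i] d_pos by (intro mult_left_mono) auto
    then show "\<theta> i - \<theta> j \<le> 2 * pi - 2 * d"
      using n_d by (simp add: \<theta>_def algebra_simps)
  qed (use d_pos in simp)
  show ?thesis
  proof (cases "pos j < pos i")
    case False
    then have "pos i < pos j"
      using assms pos_inject[of i j] by simp
    then show ?thesis
      using *[of i j] by (metis cos_minus minus_diff_eq)
  qed (rule *)
qed

text \<open>Any vertex off the edge from \<open>k\<close> to \<open>S k\<close> is at angle at least
  \<open>3 * d\<close> from the direction of the midpoint of that edge, whichever way round.\<close>

lemma cos_theta_midpoint_le:
  assumes "j \<noteq> k" "j \<noteq> S k"
  shows "cos (\<theta> j - (\<theta> k + d)) \<le> cos (3 * d)"
proof (cases "pos k < pos j")
  case True
  then have "pos j \<noteq> Suc (pos k)"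
    using assms(2) vertex_pos[of j] by (auto simp: S_def)
  then have "2 * d * 2 \<le> 2 * d * (real (pos j) - real (pos k))"
    "2 * d * (real (pos j) - real (pos k)) \<le> 2 * d * (real CARD('n) - 1)"
    using True d_pos pos_less[of j] by (intro mult_left_mono; auto)+
  then have "3 * d \<le> \<theta> j - (\<theta> k + d)" "\<theta> j - (\<theta> k + d) \<le> 2 * pi - 3 * d"
    using n_d by (simp_all add: \<theta>_def algebra_simps)
  then show ?thesis
    using d_pos by (intro cos_le_cos) auto
next
  case False
  then have less: "pos j < pos k"
    using assms(1) pos_inject[of j k] by simp
  \<comment> \<open>The closing edge of the polygon is the one case in which \<open>j\<close>
    precedes \<open>k\<close> in position and yet equals \<open>S k\<close>. Excluding it improves
    the bound on the difference of positions to \<open>CARD('n) - 2\<close>.\<close>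
  have "\<not> (pos j = 0 \<and> Suc (pos k) = CARD('n))"
    using assms(2) by (auto simp: S_def pos_vertex simp flip: pos_inject)
  then have "2 * d * 1 \<le> 2 * d * (real (pos k) - real (pos j))"
    "2 * d * (real (pos k) - real (pos j)) \<le> 2 * d * (real CARD('n) - 2)"
    using less d_pos pos_less[of k] by (intro mult_left_mono; auto)+
  then have "3 * d \<le> \<theta> k + d - \<theta> j" "\<theta> k + d - \<theta> j \<le> 2 * pi - 3 * d"
    using n_d by (simp_all add: \<theta>_def algebra_simps)
  then have "cos (\<theta> k + d - \<theta> j) \<le> cos (3 * d)"
    using d_pos by (intro cos_le_cos) auto
  then show ?thesis
    by (metis cos_minus minus_diff_eq)
qed

lemma sum_S: "(\<Sum>i\<in>UNIV. f (S i)) = (\<Sum>i\<in>UNIV. f i)"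
  by (rule sum.reindex_bij_betw[OF bij_S])

text \<open>The planar vector formed by the two sums is fixed by the rotation through
  \<open>t\<close>, which fixes only the origin.\<close>

lemma sum_rotation_zero:
  fixes f g :: "'n \<Rightarrow> real"
  assumes f: "\<And>i. f (S i) = f i * cos t - g i * sin t"
    and g: "\<And>i. g (S i) = f i * sin t + g i * cos t" and t: "cos t \<noteq> 1"
  shows "(\<Sum>i\<in>UNIV. f i) = 0" "(\<Sum>i\<in>UNIV. g i) = 0"
proof -
  define p q where "p = (\<Sum>i\<in>UNIV. f i)" and "q = (\<Sum>i\<in>UNIV. g i)"
  have p: "p = p * cos t - q * sin t"
    unfolding p_def q_def by (subst sum_S[symmetric]) (simp add: f sum_subtractf sum_distrib_right)
  have q: "q = p * sin t + q * cos t"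
    unfolding p_def q_def by (subst (1) sum_S[symmetric]) (simp add: g sum.distrib sum_distrib_right)
  have "(1 - cos t) * (p\<^sup>2 + q\<^sup>2) = p * (p - p * cos t + q * sin t) + q * (q - p * sin t - q * cos t)"
    by (simp add: algebra_simps power2_eq_square)
  also have "\<dots> = 0"
  proof -
    have "p - p * cos t + q * sin t = 0" "q - p * sin t - q * cos t = 0"
      using p q by linarith+
    then show ?thesis
      by (simp only: mult_zero_right add_0)
  qed
  finally have "p\<^sup>2 + q\<^sup>2 = 0"
    using t by simp
  then show "(\<Sum>i\<in>UNIV. f i) = 0" "(\<Sum>i\<in>UNIV. g i) = 0"
    by (simp_all add: p_def q_def)
qed

lemma cos_ne_one:
  assumes "0 < t" "t < 2 * pi"
  shows "cos t \<noteq> 1"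
proof
  assume "cos t = 1"
  then have "sin (t / 2) = 0"
    using cos_double_sin[of "t / 2"] by simp
  then show False
    using sin_gt_zero[of "t / 2"] assms by simp
qed

lemma sum_cos_theta: "(\<Sum>i\<in>UNIV. cos (\<theta> i - t)) = 0"
  and sum_sin_theta: "(\<Sum>i\<in>UNIV. sin (\<theta> i - t)) = 0"
proof -
  have 1: "cos (2 * d) \<noteq> 1"
    using d_pos d_le by (intro cos_ne_one) auto
  have S: "cos (\<theta> (S i) - t) = cos (\<theta> i - t) * cos (2 * d) - sin (\<theta> i - t) * sin (2 * d)"
    "sin (\<theta> (S i) - t) = cos (\<theta> i - t) * sin (2 * d) + sin (\<theta> i - t) * cos (2 * d)" for i
    using cos_theta_S[of i "- t"] sin_theta_S[of i "- t"]
      cos_add[of "\<theta> i - t" "2 * d"] sin_add[of "\<theta> i - t" "2 * d"] by (simp_all add: algebra_simps)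
  show "(\<Sum>i\<in>UNIV. cos (\<theta> i - t)) = 0" "(\<Sum>i\<in>UNIV. sin (\<theta> i - t)) = 0"
    using sum_rotation_zero[where f = "\<lambda>i. cos (\<theta> i - t)" and g = "\<lambda>i. sin (\<theta> i - t)", OF S 1]
    by simp_all
qed

lemma sum_cos_double_theta: "(\<Sum>i\<in>UNIV. cos (2 * (\<theta> i - t))) = 0"
  and sum_sin_double_theta: "(\<Sum>i\<in>UNIV. sin (2 * (\<theta> i - t))) = 0"
proof -
  have 1: "cos (4 * d) \<noteq> 1"
    using d_pos d_le by (intro cos_ne_one) auto
  have t: "cos (\<theta> (S i) - t) = cos (\<theta> i - t + 2 * d)" "sin (\<theta> (S i) - t) = sin (\<theta> i - t + 2 * d)" for i
    using cos_theta_S[of i "- t"] sin_theta_S[of i "- t"] by (simp_all add: algebra_simps)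
  have arg: "2 * (\<theta> i - t) + 4 * d = 2 * (\<theta> i - t + 2 * d)" for i
    by simp
  have double: "cos (2 * (\<theta> (S i) - t)) = cos (2 * (\<theta> i - t) + 4 * d)"
    "sin (2 * (\<theta> (S i) - t)) = sin (2 * (\<theta> i - t) + 4 * d)" for i
    unfolding arg by (simp_all only: cos_double sin_double t)
  have S: "cos (2 * (\<theta> (S i) - t)) = cos (2 * (\<theta> i - t)) * cos (4 * d) - sin (2 * (\<theta> i - t)) * sin (4 * d)"
    "sin (2 * (\<theta> (S i) - t)) = cos (2 * (\<theta> i - t)) * sin (4 * d) + sin (2 * (\<theta> i - t)) * cos (4 * d)" for i
    by (simp_all only: double cos_add sin_add add.commute mult.commute)
  show "(\<Sum>i\<in>UNIV. cos (2 * (\<theta> i - t))) = 0" "(\<Sum>i\<in>UNIV. sin (2 * (\<theta> i - t))) = 0"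
    using sum_rotation_zero[where f = "\<lambda>i. cos (2 * (\<theta> i - t))"
        and g = "\<lambda>i. sin (2 * (\<theta> i - t))", OF S 1]
    by simp_all
qed

lemma sum_cos_squared_theta: "(\<Sum>i\<in>UNIV. (cos (\<theta> i - t))\<^sup>2) = real CARD('n) / 2"
proof -
  have "(cos s)\<^sup>2 = (1 + cos (2 * s)) / 2" for s :: real
    by (simp add: cos_double_cos)
  then have "(\<Sum>i\<in>UNIV. (cos (\<theta> i - t))\<^sup>2) = (\<Sum>i\<in>UNIV. 1 + cos (2 * (\<theta> i - t))) / 2"
    by (simp only: sum_divide_distrib)
  then show ?thesis
    by (simp only: sum.distrib sum_cos_double_theta) simp
qed

lemma sum_sin_squared_theta: "(\<Sum>i\<in>UNIV. (sin (\<theta> i - t))\<^sup>2) = real CARD('n) / 2"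
  by (simp add: sin_squared_eq sum_subtractf sum_cos_squared_theta)

lemma sum_sin_cos_theta: "(\<Sum>i\<in>UNIV. sin (\<theta> i - t) * cos (\<theta> i - t)) = 0"
proof -
  have "sin s * cos s = sin (2 * s) / 2" for s :: real
    by (simp add: sin_double)
  then have "(\<Sum>i\<in>UNIV. sin (\<theta> i - t) * cos (\<theta> i - t)) = (\<Sum>i\<in>UNIV. sin (2 * (\<theta> i - t))) / 2"
    by (simp only: sum_divide_distrib)
  then show ?thesis
    by (simp only: sum_sin_double_theta)
qed

section \<open>The circulant matrix and its zeros \<open>u k\<close>\<close>

text \<open>The constants are chosen so that \<open>A *v u k\<close> is supported on \<open>k\<close> and \<open>S k\<close>: the denominators of
  \<open>a / \<alpha>\<close> and \<open>b\<close> are the coordinate sum of \<open>u k\<close> and minus its cosine coefficient. Any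
  \<open>\<epsilon>\<close> small enough that \<open>\<alpha>\<close> exceeds \<open>cos (3 * d)\<close> and \<open>\<epsilon> * \<eta>\<close> stays below \<open>(sin d)\<^sup>2\<close> would do.\<close>

definition \<eta> :: real where "\<eta> = cos d"
definition \<epsilon> :: real where "\<epsilon> = (sin d)\<^sup>2 / 2"
definition \<alpha> :: real where "\<alpha> = \<eta> - \<epsilon>"
definition a :: real where "a = \<alpha> / (\<alpha> * real CARD('n) + 2 * \<epsilon>)"
definition b :: real where "b = 1 / (real CARD('n) / 2 - 2 * \<epsilon> * \<eta>)"

definition A :: "real^'n^'n" where
  "A = (\<chi> i j. (if i = j then 1 else 0) - a - b * cos (\<theta> i - \<theta> j))"

definition u :: "'n \<Rightarrow> real^'n" where
  "u k = (\<chi> j. if j = k \<or> j = S k then 0 else \<alpha> - cos (\<theta> j - (\<theta> k + d)))"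

lemma eta_ge: "1 / 2 \<le> \<eta>" and eta_le: "\<eta> \<le> 1"
  using cos_monotone_0_pi_le[of d "pi / 3"] d_pos d_le by (simp_all add: \<eta>_def cos_60)

lemma eps_pos: "0 < \<epsilon>"
  using sin_gt_zero[OF d_pos] d_le d_pos by (simp add: \<epsilon>_def)

lemma eps_eta: "2 * \<epsilon> = 1 - \<eta>\<^sup>2"
  by (simp add: \<epsilon>_def \<eta>_def sin_squared_eq)

lemma eps_le: "\<epsilon> \<le> 3 / 8"
  using eps_eta power_mono[OF eta_ge, of 2] by (simp add: power2_eq_square)

lemma alpha_pos: "0 < \<alpha>"
  using eta_ge eps_le by (simp add: \<alpha>_def)

text \<open>By the triple-angle formula the gap between \<open>\<eta>\<close> and
  \<open>cos (3 * d)\<close> is \<open>8 * \<eta> * \<epsilon>\<close>, more than the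
  \<open>\<epsilon>\<close> subtracted in \<open>\<alpha>\<close>. It makes \<open>u k\<close>
  positive away from \<open>k\<close> and \<open>S k\<close>.\<close>

lemma cos_3d_less_alpha: "cos (3 * d) < \<alpha>"
proof -
  have "cos (3 * d) = 4 * \<eta> ^ 3 - 3 * \<eta>"
    by (simp add: cos_treble_cos \<eta>_def)
  then have "\<eta> - cos (3 * d) = 4 * \<eta> * (1 - \<eta>\<^sup>2)"
    by (simp add: algebra_simps power2_eq_square power3_eq_cube)
  also have "\<dots> = (8 * \<eta>) * \<epsilon>"
    using eps_eta by simp
  also have "\<dots> > 1 * \<epsilon>"
    using eta_ge eps_pos by (intro mult_strict_right_mono) auto
  finally show ?thesis
    by (simp add: \<alpha>_def)
qed

lemma b_denominator_pos: "0 < real CARD('n) / 2 - 2 * \<epsilon> * \<eta>"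
proof -
  have "2 * \<epsilon> * \<eta> \<le> 2 * (3 / 8) * 1"
    using eps_le eps_pos eta_le eta_ge by (intro mult_mono) auto
  then show ?thesis
    using card_ge by simp
qed

lemma b_pos: "0 < b"
  using b_denominator_pos by (simp add: b_def)

lemma a_eq: "a * (\<alpha> * real CARD('n) + 2 * \<epsilon>) = \<alpha>"
proof -
  have "0 < \<alpha> * real CARD('n) + 2 * \<epsilon>"
    using alpha_pos eps_pos by (simp add: add_pos_pos)
  then show ?thesis
    by (simp add: a_def)
qed

lemma b_eq: "b * (real CARD('n) / 2 - 2 * \<epsilon> * \<eta>) = 1"
  using b_denominator_pos by (simp add: b_def)

definition total :: "real^'n \<Rightarrow> real" where
  "total x = (\<Sum>j\<in>UNIV. x $ j)"
definition cos_part :: "real \<Rightarrow> real^'n \<Rightarrow> real" where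
  "cos_part t x = (\<Sum>j\<in>UNIV. x $ j * cos (\<theta> j - t))"
definition sin_part :: "real \<Rightarrow> real^'n \<Rightarrow> real" where
  "sin_part t x = (\<Sum>j\<in>UNIV. x $ j * sin (\<theta> j - t))"

text \<open>The image of \<open>x\<close> under \<open>a J + b C\<close> (in fact of rank at most
  three), read off from three scalars. The reference angle \<open>t\<close> is arbitrary; placing it
  at the midpoint of an edge exploits symmetry.\<close>

definition low_part :: "real \<Rightarrow> real^'n \<Rightarrow> 'n \<Rightarrow> real" where
  "low_part t x i = a * total x + b * (cos (\<theta> i - t) * cos_part t x + sin (\<theta> i - t) * sin_part t x)"

lemma A_mult: "(A *v x) $ i = x $ i - low_part t x i"
proof -
  have "cos (\<theta> i - \<theta> j) = cos (\<theta> i - t) * cos (\<theta> j - t) + sin (\<theta> i - t) * sin (\<theta> j - t)" for j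
    using cos_diff[of "\<theta> i - t" "\<theta> j - t"] by simp
  then have "(A *v x) $ i = (\<Sum>j\<in>UNIV. (if i = j then x $ j else 0) - a * x $ j
      - b * (cos (\<theta> i - t) * (x $ j * cos (\<theta> j - t)) + sin (\<theta> i - t) * (x $ j * sin (\<theta> j - t))))"
    unfolding matrix_vector_mult_def A_def by (auto intro!: sum.cong simp: algebra_simps)
  then show ?thesis
    by (simp add: low_part_def total_def cos_part_def sin_part_def sum_subtractf sum.distrib distrib_left
        flip: sum_distrib_left)
qed

lemma transpose_A: "transpose A = A"
  by (simp add: transpose_def A_def vec_eq_iff) (metis cos_minus minus_diff_eq)

lemma inner_low_part:
  "(\<Sum>i\<in>UNIV. x $ i * low_part t y i)
     = a * total x * total y + b * (cos_part t x * cos_part t y + sin_part t x * sin_part t y)"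
  by (simp add: low_part_def total_def[of x] cos_part_def[of t x] sin_part_def[of t x]
      sum_distrib_left sum_distrib_right sum.distrib algebra_simps)

lemma quadratic_A:
  "x \<bullet> (A *v x) = (\<Sum>i\<in>UNIV. (x $ i)\<^sup>2) - a * (total x)\<^sup>2 - b * ((cos_part t x)\<^sup>2 + (sin_part t x)\<^sup>2)"
proof -
  have "x \<bullet> (A *v x) = (\<Sum>i\<in>UNIV. x $ i * x $ i) - (\<Sum>i\<in>UNIV. x $ i * low_part t x i)"
    by (simp add: inner_vec_def A_mult[of _ _ t] right_diff_distrib sum_subtractf)
  then show ?thesis
    by (simp add: inner_low_part power2_eq_square)
qed

lemma cos_theta_ends: "cos (\<theta> k - (\<theta> k + d)) = \<eta>" "cos (\<theta> (S k) - (\<theta> k + d)) = \<eta>"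
  using cos_theta_S[of k "- (\<theta> k + d)", unfolded add_uminus_conv_diff] by (simp_all add: \<eta>_def)

lemma sin_theta_ends: "sin (\<theta> k - (\<theta> k + d)) = - sin d" "sin (\<theta> (S k) - (\<theta> k + d)) = sin d"
  using sin_theta_S[of k "- (\<theta> k + d)", unfolded add_uminus_conv_diff] by simp_all

text \<open>At both ends of the edge the cosine is \<open>\<eta>\<close>, so the trigonometric
  expression equals \<open>- \<epsilon>\<close> there and a correction by \<open>\<epsilon>\<close>
  gives the zeros. In this form all sums over \<open>u k\<close> are explicit.\<close>

lemma u_eq: "u k $ j = \<alpha> - cos (\<theta> j - (\<theta> k + d))
    + ((if j = k then \<epsilon> else 0) + (if j = S k then \<epsilon> else 0))"
  using S_distinct(1)[of k] by (auto simp: u_def cos_theta_ends \<alpha>_def \<eta>_def)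

lemma u_ends [simp]: "u k $ k = 0" "u k $ S k = 0"
  by (simp_all add: u_def)

lemma u_pos: "j \<noteq> k \<Longrightarrow> j \<noteq> S k \<Longrightarrow> 0 < u k $ j"
  using cos_theta_midpoint_le[of j k] cos_3d_less_alpha by (simp add: u_def)

lemma u_nonneg: "0 \<le> u k $ j"
  using u_pos[of j k] by (cases "j = k \<or> j = S k") (auto simp: less_imp_le)

lemma sum_two_points:
  fixes f :: "'n \<Rightarrow> real"
  shows
  "(\<Sum>j\<in>UNIV. ((if j = k then c else 0) + (if j = l then c else 0)) * f j) = c * (f k + f l)"
  by (simp add: distrib_right sum.distrib if_distrib[of "\<lambda>x. x * _"] distrib_left cong: if_cong)

lemma total_u: "total (u k) = \<alpha> * real CARD('n) + 2 * \<epsilon>"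
  using sum_two_points[of k \<epsilon> "S k" "\<lambda>_. 1"]
  by (simp add: total_def u_eq sum.distrib sum_subtractf sum_cos_theta)

lemma cos_part_u: "cos_part (\<theta> k + d) (u k) = - (real CARD('n) / 2 - 2 * \<epsilon> * \<eta>)"
proof -
  let ?t = "\<theta> k + d"
  have "cos_part ?t (u k) = (\<Sum>j\<in>UNIV. \<alpha> * cos (\<theta> j - ?t) - (cos (\<theta> j - ?t))\<^sup>2
      + ((if j = k then \<epsilon> else 0) + (if j = S k then \<epsilon> else 0)) * cos (\<theta> j - ?t))"
    unfolding cos_part_def u_eq by (intro sum.cong) (simp_all add: algebra_simps power2_eq_square)
  also have "\<dots> = - (real CARD('n) / 2 - 2 * \<epsilon> * \<eta>)"
    unfolding sum.distrib sum_subtractf sum_two_points sum_distrib_left[symmetric]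
      sum_cos_theta sum_cos_squared_theta cos_theta_ends by simp
  finally show ?thesis .
qed

lemma sin_part_u: "sin_part (\<theta> k + d) (u k) = 0"
proof -
  let ?t = "\<theta> k + d"
  have "sin_part ?t (u k) = (\<Sum>j\<in>UNIV. \<alpha> * sin (\<theta> j - ?t) - sin (\<theta> j - ?t) * cos (\<theta> j - ?t)
      + ((if j = k then \<epsilon> else 0) + (if j = S k then \<epsilon> else 0)) * sin (\<theta> j - ?t))"
    unfolding sin_part_def u_eq by (intro sum.cong) (simp_all add: algebra_simps)
  also have "\<dots> = 0"
    unfolding sum.distrib sum_subtractf sum_two_points sum_distrib_left[symmetric]
      sum_sin_theta sum_sin_cos_theta sin_theta_ends by simp
  finally show ?thesis .
qed

text \<open>By the choice of \<open>a\<close> and \<open>b\<close>, the low-rank part reproduces the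
  trigonometric part of \<open>u k\<close>, leaving only the two corrections.\<close>

lemma A_mult_u: "A *v u k = \<epsilon> *\<^sub>R (axis k 1 + axis (S k) 1)"
proof -
  have "(A *v u k) $ i = u k $ i - \<alpha> + cos (\<theta> i - (\<theta> k + d))" for i
  proof -
    have "b * (cos (\<theta> i - (\<theta> k + d)) * cos_part (\<theta> k + d) (u k)) = - cos (\<theta> i - (\<theta> k + d))"
      using b_eq unfolding cos_part_u by (metis mult.left_commute mult.right_neutral mult_minus_right)
    then show ?thesis
      using a_eq by (simp add: A_mult[of _ _ "\<theta> k + d"] low_part_def total_u sin_part_u)
  qed
  then show ?thesis
    by (simp add: vec_eq_iff u_eq axis_def)
qed

text \<open>Constants, cosine and sine are orthogonal on the polygon.\<close>

lemma sum_trig_squared: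
  "(\<Sum>i\<in>UNIV. (p + q * cos (\<theta> i - t) + r * sin (\<theta> i - t))\<^sup>2)
     = real CARD('n) * p\<^sup>2 + real CARD('n) / 2 * (q\<^sup>2 + r\<^sup>2)"
proof -
  have "(p + q * cos s + r * sin s)\<^sup>2
      = p\<^sup>2 + q\<^sup>2 * (cos s)\<^sup>2 + r\<^sup>2 * (sin s)\<^sup>2 + 2 * p * q * cos s + 2 * p * r * sin s
        + 2 * q * r * (sin s * cos s)" for s :: real
    by (simp add: power2_eq_square algebra_simps)
  then show ?thesis
    by (simp only: sum.distrib sum_cos_theta sum_sin_theta sum_cos_squared_theta
        sum_sin_squared_theta sum_sin_cos_theta flip: sum_distrib_left) (simp add: algebra_simps)
qed

text \<open>Completing squares over all vertices except \<open>k\<close> and \<open>S k\<close>: with \<open>x\<close> vanishing there, the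
  form of \<open>A\<close> is a sum of squares.\<close>

lemma quadratic_A_adjacent_zeros:
  fixes x :: "real^'n" and k :: 'n
  assumes "x $ k = 0" "x $ S k = 0"
  defines "t \<equiv> \<theta> k + d"
  shows "x \<bullet> (A *v x) = (\<Sum>j\<in>UNIV - {k, S k}. (x $ j - low_part t x j)\<^sup>2)
    + 2 * \<eta> / \<alpha> * (a * total x + \<alpha> * b * cos_part t x)\<^sup>2
    + 2 * ((sin d)\<^sup>2 - \<epsilon> * \<eta>) * (b * sin_part t x)\<^sup>2"
proof -
  define T C N where "T = total x" and "C = cos_part t x" and "N = sin_part t x"
  define G where "G = low_part t x"
  define R where "R = (\<Sum>j\<in>UNIV - {k, S k}. (x $ j - G j)\<^sup>2)"
  define n where "n = real CARD('n)"
  have G: "G j = a * T + (b * C) * cos (\<theta> j - t) + (b * N) * sin (\<theta> j - t)" for j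
    by (simp add: G_def low_part_def T_def C_def N_def algebra_simps)
  have ends: "G k = a * T + b * \<eta> * C - b * sin d * N" "G (S k) = a * T + b * \<eta> * C + b * sin d * N"
    unfolding G unfolding t_def cos_theta_ends sin_theta_ends by (simp_all add: algebra_simps)
  \<comment> \<open>Since \<open>x\<close> vanishes at the two ends, the residuals there are just
    the values of \<open>G\<close>.\<close>
  have "(\<Sum>j\<in>UNIV. (x $ j - G j)\<^sup>2) = R + (G k)\<^sup>2 + (G (S k))\<^sup>2"
    using S_distinct(1)[of k] assms(1,2)
      sum.subset_diff[of "{k, S k}" UNIV "\<lambda>j. (x $ j - G j)\<^sup>2"] by (simp add: R_def)
  moreover have "(\<Sum>j\<in>UNIV. (x $ j - G j)\<^sup>2)
      = (\<Sum>j\<in>UNIV. (x $ j)\<^sup>2) - 2 * (\<Sum>j\<in>UNIV. x $ j * G j) + (\<Sum>j\<in>UNIV. (G j)\<^sup>2)"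
    by (simp add: power2_diff sum.distrib sum_subtractf sum_distrib_left mult.assoc algebra_simps)
  moreover have "(\<Sum>j\<in>UNIV. x $ j * G j) = a * T\<^sup>2 + b * (C\<^sup>2 + N\<^sup>2)"
    by (simp add: G_def inner_low_part T_def C_def N_def power2_eq_square)
  moreover have "(\<Sum>j\<in>UNIV. (G j)\<^sup>2) = n * (a * T)\<^sup>2 + n / 2 * ((b * C)\<^sup>2 + (b * N)\<^sup>2)"
    unfolding G by (simp add: sum_trig_squared n_def)
  moreover have "x \<bullet> (A *v x) = (\<Sum>i\<in>UNIV. (x $ i)\<^sup>2) - a * T\<^sup>2 - b * (C\<^sup>2 + N\<^sup>2)"
    by (simp add: quadratic_A[of x t] T_def C_def N_def)
  ultimately have q: "x \<bullet> (A *v x) = R + (G k)\<^sup>2 + (G (S k))\<^sup>2 + (a - n * a\<^sup>2) * T\<^sup>2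
      + (b - n / 2 * b\<^sup>2) * (C\<^sup>2 + N\<^sup>2)"
    by (simp add: algebra_simps power_mult_distrib add_divide_distrib)
  have "\<alpha> * (a - n * a\<^sup>2) = 2 * \<epsilon> * a\<^sup>2"
  proof -
    have "a * (a * (\<alpha> * n + 2 * \<epsilon>)) = a * \<alpha>"
      unfolding n_def by (simp only: a_eq)
    then show ?thesis
      by (simp add: algebra_simps power2_eq_square)
  qed
  then have a: "a - n * a\<^sup>2 = 2 * \<epsilon> * a\<^sup>2 / \<alpha>"
    using alpha_pos by (simp add: field_simps)
  have "b * (b * (n / 2 - 2 * \<epsilon> * \<eta>)) = b"
    unfolding n_def by (simp only: b_eq)
  then have b: "b - n / 2 * b\<^sup>2 = - (2 * \<epsilon> * \<eta> * b\<^sup>2)"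
    by (simp add: algebra_simps power2_eq_square)
  \<comment> \<open>Writing \<open>\<epsilon>\<close> and \<open>\<eta>\<close> as multiples of
    \<open>\<alpha>\<close> removes the denominator, so the square completion becomes a polynomial
    identity.\<close>
  define e where "e = \<epsilon> / \<alpha>"
  have e: "\<epsilon> = \<alpha> * e" "\<eta> = \<alpha> * (1 + e)"
    using alpha_pos by (simp_all add: e_def distrib_left) (simp add: \<alpha>_def)
  have c: "2 * \<eta> / \<alpha> = 2 * (1 + e)" "2 * \<epsilon> * a\<^sup>2 / \<alpha> = 2 * e * a\<^sup>2"
    using alpha_pos unfolding e by simp_all
  have "2 * e * a\<^sup>2 * T\<^sup>2 + 2 * (a * T + b * \<eta> * C)\<^sup>2 - 2 * \<epsilon> * \<eta> * b\<^sup>2 * C\<^sup>2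
      = 2 * (1 + e) * (a * T + \<alpha> * b * C)\<^sup>2"
    unfolding e by (simp add: algebra_simps power2_eq_square)
  moreover have "(p - q)\<^sup>2 + (p + q)\<^sup>2 = 2 * p\<^sup>2 + 2 * q\<^sup>2" for p q :: real
    by (simp add: algebra_simps power2_eq_square)
  note this[of "a * T + b * \<eta> * C" "b * sin d * N"]
  moreover have "- (2 * \<epsilon> * \<eta> * b\<^sup>2) * (C\<^sup>2 + N\<^sup>2) + 2 * (b * sin d * N)\<^sup>2
      = 2 * ((sin d)\<^sup>2 - \<epsilon> * \<eta>) * (b * N)\<^sup>2 - 2 * \<epsilon> * \<eta> * b\<^sup>2 * C\<^sup>2"
    by (simp add: algebra_simps power2_eq_square)
  ultimately have "x \<bullet> (A *v x) = R + 2 * \<eta> / \<alpha> * (a * T + \<alpha> * b * C)\<^sup>2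
      + 2 * ((sin d)\<^sup>2 - \<epsilon> * \<eta>) * (b * N)\<^sup>2"
    unfolding q a b ends c by linarith
  then show ?thesis
    by (simp only: R_def G_def T_def C_def N_def)
qed

lemma sin_squared_greater: "0 < (sin d)\<^sup>2 - \<epsilon> * \<eta>"
proof -
  have "\<epsilon> * \<eta> \<le> \<epsilon> * 1"
    using eps_pos eta_le by (intro mult_left_mono) auto
  then show ?thesis
    using eps_pos by (simp add: \<epsilon>_def)
qed

lemma quadratic_A_nonneg_adjacent_zeros:
  assumes "x $ k = 0" "x $ S k = 0"
  shows "0 \<le> x \<bullet> (A *v x)"
  unfolding quadratic_A_adjacent_zeros[OF assms]
  using alpha_pos eta_ge sin_squared_greater by (intro add_nonneg_nonneg sum_nonneg mult_nonneg_nonneg) auto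

text \<open>Each of the three nonnegative parts vanishes: the last kills the sine part, the middle
  one ties the cosine part to the total, and the first then fixes the entries of \<open>x\<close>
  off the edge.\<close>

lemma quadratic_A_zero_adjacent_zeros:
  assumes x: "x $ k = 0" "x $ S k = 0" and "x \<bullet> (A *v x) = 0"
  shows "\<exists>c. x = c *\<^sub>R u k"
proof -
  define t where "t = \<theta> k + d"
  have "0 \<le> (\<Sum>j\<in>UNIV - {k, S k}. (x $ j - low_part t x j)\<^sup>2)"
    "0 \<le> 2 * \<eta> / \<alpha> * (a * total x + \<alpha> * b * cos_part t x)\<^sup>2"
    "0 \<le> 2 * ((sin d)\<^sup>2 - \<epsilon> * \<eta>) * (b * sin_part t x)\<^sup>2"
    using alpha_pos eta_ge sin_squared_greater by (auto intro!: sum_nonneg mult_nonneg_nonneg)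
  then have *: "(\<Sum>j\<in>UNIV - {k, S k}. (x $ j - low_part t x j)\<^sup>2) = 0"
    "2 * \<eta> / \<alpha> * (a * total x + \<alpha> * b * cos_part t x)\<^sup>2 = 0"
    "2 * ((sin d)\<^sup>2 - \<epsilon> * \<eta>) * (b * sin_part t x)\<^sup>2 = 0"
    using quadratic_A_adjacent_zeros[OF x] assms(3) unfolding t_def by linarith+
  have C: "b * cos_part t x = - (a * total x) / \<alpha>"
    using *(2) alpha_pos eta_ge by (simp add: field_simps)
  have N: "sin_part t x = 0"
    using *(3) sin_squared_greater b_pos by simp
  have "x $ j = (a * total x / \<alpha>) * u k $ j" for j
  proof (cases "j = k \<or> j = S k")
    case False
    then have "x $ j = low_part t x j"
      using *(1) by (subst (asm) sum_nonneg_eq_0_iff) auto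
    also have "\<dots> = a * total x + cos (\<theta> j - t) * (b * cos_part t x)"
      by (simp add: low_part_def N)
    also have "\<dots> = (a * total x / \<alpha>) * (\<alpha> - cos (\<theta> j - t))"
      using alpha_pos unfolding C by (simp add: field_simps)
    finally show ?thesis
      using False by (simp add: u_def t_def)
  qed (use x in auto)
  then show ?thesis
    by (intro exI[of _ "a * total x / \<alpha>"]) (simp add: vec_eq_iff)
qed

section \<open>Copositivity of the circulant matrix\<close>

lemma angle_bounds:
  assumes "cos (s + 2 * d) < cos s" "cos (s - 2 * d) < cos s"
  shows "cos d < cos s" "\<bar>sin s\<bar> < sin d"
proof -
  have d: "0 < sin d" "0 < cos d"
    using sin_gt_zero[of d] d_pos d_le eta_ge unfolding \<eta>_def by linarith+
  \<comment> \<open>Applied at \<open>s + d\<close> and \<open>s - d\<close>, the product formula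
    turns the hypotheses into signs of sines, which place \<open>s\<close> within \<open>d\<close>
    of direction 0 modulo a full turn.\<close>
  have diff: "cos (w - d) - cos (w + d) = 2 * sin d * sin w" for w
    by (simp add: cos_add cos_diff)
  have "0 < 2 * sin d * sin (s + d)" "2 * sin d * sin (s - d) < 0"
    using assms diff[of "s + d"] diff[of "s - d"] by (simp_all add: algebra_simps)
  then have "0 < sin (s + d)" "sin (s - d) < 0"
    using d by (simp_all add: zero_less_mult_iff mult_less_0_iff)
  then have pos: "0 < sin d * cos s + cos d * sin s" "0 < sin d * cos s - cos d * sin s"
    by (simp_all add: sin_add sin_diff algebra_simps)
  then have "0 < sin d * cos s"
    by linarith
  then have cos_pos: "0 < cos s"
    using d by (simp add: zero_less_mult_iff)
  have "0 < (sin d * cos s + cos d * sin s) * (sin d * cos s - cos d * sin s)"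
    using pos by simp
  also have "\<dots> = (sin d)\<^sup>2 * (cos s)\<^sup>2 - (cos d)\<^sup>2 * (sin s)\<^sup>2"
    by (simp add: algebra_simps power2_eq_square)
  also have "\<dots> = (sin d)\<^sup>2 - (sin s)\<^sup>2"
    by (simp add: cos_squared_eq algebra_simps)
  finally have sq: "(sin s)\<^sup>2 < (sin d)\<^sup>2"
    by simp
  then show "\<bar>sin s\<bar> < sin d"
    using d(1) power2_less_imp_less[of "\<bar>sin s\<bar>" "sin d"] by simp
  have "(cos d)\<^sup>2 < (cos s)\<^sup>2"
    unfolding cos_squared_eq using sq by linarith
  then show "cos d < cos s"
    using cos_pos power2_less_imp_less[of "cos d" "cos s"] by simp
qed

text \<open>If \<open>m\<close> is the minimum of the form of \<open>A\<close> on the standard simplex, the shifted form is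
  copositive and vanishes at a minimizer \<open>x\<close>. Its first-order conditions say that \<open>x\<close> is the
  positive part of \<open>c - r * cos (\<theta> i - \<psi>)\<close>, so its zero set is a circular arc of vertices: either
  it contains two neighbours or at most one vertex, and then pairing with some \<open>u k\<close> excludes it.\<close>

lemma minimizer_adjacent_zeros:
  fixes x :: "real^'n"
  assumes m: "m \<le> 0" and M: "copositive (A - m *\<^sub>R outer_square 1)"
    and x: "\<And>i. 0 \<le> x $ i" "x \<noteq> 0" "x \<bullet> ((A - m *\<^sub>R outer_square 1) *v x) = 0"
  shows "\<exists>k. x $ k = 0 \<and> x $ S k = 0"
proof (rule ccontr)
  assume none: "\<not> ?thesis"
  define M where "M = A - m *\<^sub>R outer_square 1"
  have inner1: "1 \<bullet> x = total x" for x :: "real^'n"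
    by (simp add: inner_vec_def total_def)
  have M_mult: "M *v y = A *v y - (m * total y) *\<^sub>R 1" for y
    by (simp add: M_def matrix_vector_mult_diff_rdistrib outer_square_vector_mult inner1
        scaleR_matrix_vector_assoc[symmetric] del: scaleR_matrix_vector_assoc)
  have sym: "transpose M = M"
    using transpose_A by (simp add: M_def transpose_def vec_eq_iff)
  define f where "f i = low_part 0 x i + m * total x" for i
  have Mf: "(M *v x) $ i = x $ i - f i" for i
    by (simp add: M_mult A_mult[of _ _ 0] f_def)
  note zero = copositive_zero[OF sym M[folded M_def] x(1) x(3)[folded M_def]]
  have f_le: "f i \<le> 0" if "x $ i = 0" for i
    using zero(1)[of i] that by (simp add: Mf)
  have f_pos: "0 < f i" if "x $ i \<noteq> 0" for i
    using zero(2)[of i] that x(1)[of i] by (simp add: Mf less_le)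
  have "\<exists>i j. i \<noteq> j \<and> x $ i = 0 \<and> x $ j = 0"
  proof (rule ccontr)
    assume "\<not> ?thesis"
    then obtain k where k: "\<And>j. j \<noteq> k \<Longrightarrow> x $ j \<noteq> 0"
      by metis
    \<comment> \<open>At every vertex other than \<open>k\<close> the entry of \<open>x\<close> is
      positive, so complementary slackness applies; at \<open>k\<close> itself \<open>u k\<close>
      vanishes.\<close>
    then have "u k $ j * (M *v x) $ j = 0" for j
      using zero(2)[of j] x(1)[of j] by (cases "j = k") (auto simp: less_le)
    then have "0 = u k \<bullet> (M *v x)"
      by (simp add: inner_vec_def sum.neutral)
    also have "\<dots> = (A *v u k) \<bullet> x - m * total x * total (u k)"
      using inner1[of "u k"] dot_lmul_matrix[of "u k" A x] transpose_A
      by (simp add: M_mult inner_diff_right inner_commute vector_transpose_matrix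
          flip: transpose_matrix_vector)
    also have "\<dots> = \<epsilon> * (x $ k + x $ S k) + (- m) * (total x * total (u k))"
      by (simp add: A_mult_u inner_add_left inner_axis')
    finally have eq: "0 = \<epsilon> * (x $ k + x $ S k) + (- m) * (total x * total (u k))" .
    have "0 \<le> (- m) * (total x * total (u k))"
      using m x(1) u_nonneg by (intro mult_nonneg_nonneg) (auto simp: total_def sum_nonneg)
    moreover have "0 < \<epsilon> * (x $ k + x $ S k)"
      using eps_pos x(1)[of k] x(1)[of "S k"] k[of "S k"] S_distinct(1)[of k]
      by (intro mult_pos_pos add_nonneg_pos) (auto simp: less_le)
    ultimately show False
      using eq by linarith
  qed
  then obtain i j where ij: "i \<noteq> j" "x $ i = 0" "x $ j = 0"
    by blast
  \<comment> \<open>Polar coordinates merge the cosine and sine parts into one wave of amplitude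
    \<open>r\<close> and phase \<open>\<psi>\<close>.\<close>
  define z where "z = Complex (- b * cos_part 0 x) (- b * sin_part 0 x)"
  define r \<psi> where "r = cmod z" and "\<psi> = Arg z"
  have "rcis r \<psi> = z"
    by (simp add: r_def \<psi>_def rcis_cmod_Arg)
  then have rz: "r * cos \<psi> = - b * cos_part 0 x" "r * sin \<psi> = - b * sin_part 0 x"
    by (auto simp: z_def rcis_def complex_eq_iff)
  have r: "0 \<le> r"
    by (simp add: r_def)
  have f: "f i = (a + m) * total x - r * cos (\<theta> i - \<psi>)" for i
  proof -
    have "r * cos (\<theta> i - \<psi>) = cos (\<theta> i) * (r * cos \<psi>) + sin (\<theta> i) * (r * sin \<psi>)"
      by (simp add: cos_diff algebra_simps)
    then show ?thesis
      unfolding rz by (simp add: f_def low_part_def algebra_simps)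
  qed
  \<comment> \<open>A zero without neighbouring zeros has a smaller \<open>f\<close> than both
    neighbours, so the phase lies within \<open>d\<close> of it.\<close>
  have bounds: "cos d < cos (\<theta> i - \<psi>) \<and> \<bar>sin (\<theta> i - \<psi>)\<bar> < sin d" if "x $ i = 0" for i
  proof -
    obtain h where h: "i = S h"
      using surj_S by blast
    have "x $ S i \<noteq> 0" "x $ h \<noteq> 0"
      using none that h by auto
    then have "f i < f (S i)" "f i < f h"
      using f_le[OF that] f_pos[of "S i"] f_pos[of h] by linarith+
    then have "r * cos (\<theta> (S i) - \<psi>) < r * cos (\<theta> i - \<psi>)" "r * cos (\<theta> h - \<psi>) < r * cos (\<theta> i - \<psi>)"
      by (simp_all add: f)
    moreover have "cos (\<theta> (S i) - \<psi>) = cos (\<theta> i - \<psi> + 2 * d)" "cos (\<theta> h - \<psi>) = cos (\<theta> i - \<psi> - 2 * d)"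
      using cos_theta_S[of i "- \<psi>"] cos_theta_S[of h "- \<psi> - 2 * d"]
      by (simp_all add: h algebra_simps)
    ultimately show ?thesis
      using r angle_bounds[of "\<theta> i - \<psi>"] by (auto simp: mult_less_cancel_left)
  qed
  have i: "cos d < cos (\<theta> i - \<psi>)" "\<bar>sin (\<theta> i - \<psi>)\<bar> < sin d"
    and j: "cos d < cos (\<theta> j - \<psi>)" "\<bar>sin (\<theta> j - \<psi>)\<bar> < sin d"
    using bounds ij by auto
  have "0 < cos d"
    using eta_ge by (simp add: \<eta>_def)
  then have "cos d * cos d < cos (\<theta> i - \<psi>) * cos (\<theta> j - \<psi>)"
    using i j by (intro mult_strict_mono) auto
  moreover have "\<bar>sin (\<theta> i - \<psi>)\<bar> * \<bar>sin (\<theta> j - \<psi>)\<bar> \<le> sin d * sin d"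
    using i j by (intro mult_mono) auto
  then have "- (sin d * sin d) \<le> sin (\<theta> i - \<psi>) * sin (\<theta> j - \<psi>)"
    by (simp add: abs_le_iff flip: abs_mult)
  moreover have "cos (\<theta> i - \<theta> j) = cos (\<theta> i - \<psi>) * cos (\<theta> j - \<psi>) + sin (\<theta> i - \<psi>) * sin (\<theta> j - \<psi>)"
    using cos_diff[of "\<theta> i - \<psi>" "\<theta> j - \<psi>"] by simp
  \<comment> \<open>Two vertices within \<open>d\<close> of the same phase are less than one edge
    apart.\<close>
  ultimately have "cos (2 * d) < cos (\<theta> i - \<theta> j)"
    by (simp add: cos_double power2_eq_square)
  then show False
    using cos_theta_diff_le[OF ij(1)] by simp
qed

lemma quadratic_A_shift:
  "y \<bullet> ((A - m *\<^sub>R outer_square 1) *v y) = y \<bullet> (A *v y) - m * (total y)\<^sup>2"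
proof -
  have "(1 :: real^'n) \<bullet> y = total y"
    by (simp add: inner_vec_def total_def)
  then show ?thesis
    by (simp add: inner_diff_left inner_outer_squares flip: inner_outer_square)
qed

text \<open>Were the minimum over the simplex negative, its minimizer would have two adjacent zeros,
  where the form is a sum of squares and hence nonnegative.\<close>

lemma copositive_A: "copositive A"
proof -
  define D :: "(real^'n) set" where "D = {x. (\<forall>i. 0 \<le> x $ i) \<and> total x = 1}"
  have "closed D"
    unfolding D_def total_def
    by (intro closed_Collect_conj closed_Collect_all closed_Collect_le closed_Collect_eq continuous_intros)
  moreover have "norm x \<le> 1" if "x \<in> D" for x
    using norm_le_l1_cart[of x] that by (simp add: D_def total_def)
  then have "bounded D"
    by (auto simp: bounded_iff)
  ultimately have "compact D"
    by (simp add: compact_eq_bounded_closed)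
  moreover have "(1 / real CARD('n)) *\<^sub>R 1 \<in> D"
    by (simp add: D_def total_def)
  moreover have "continuous_on D (\<lambda>x. x \<bullet> (A *v x))"
    by (intro continuous_intros matrix_vector_mult_linear_continuous_on)
  ultimately obtain y where y: "y \<in> D" "\<And>x. x \<in> D \<Longrightarrow> y \<bullet> (A *v y) \<le> x \<bullet> (A *v x)"
    using continuous_attains_inf[of D "\<lambda>x. x \<bullet> (A *v x)"] by (metis empty_iff)
  define m where "m = y \<bullet> (A *v y)"
  \<comment> \<open>The form is homogeneous of degree two, so the bound on the simplex extends to
    the orthant.\<close>
  have bound: "m * (total x)\<^sup>2 \<le> x \<bullet> (A *v x)" if x: "\<forall>i. 0 \<le> x $ i" for x
  proof (cases "total x = 0")
    case True
    then have "x = 0"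
      using x by (auto simp: total_def sum_nonneg_eq_0_iff vec_eq_iff)
    then show ?thesis
      unfolding True by simp
  next
    case False
    have "0 \<le> total x"
      using x by (simp add: total_def sum_nonneg)
    then have pos: "0 < total x"
      using False by simp
    have "total ((1 / total x) *\<^sub>R x) = 1"
      using pos by (simp add: total_def flip: sum_divide_distrib)
    then have "(1 / total x) *\<^sub>R x \<in> D"
      using x pos by (simp add: D_def)
    then have "m \<le> (1 / total x) * ((1 / total x) * (x \<bullet> (A *v x)))"
      using y(2)[of "(1 / total x) *\<^sub>R x"] by (simp add: m_def matrix_vector_mult_scaleR)
    then show ?thesis
      using pos by (simp add: field_simps power2_eq_square)
  qed
  have "0 \<le> m"
  proof (rule ccontr)
    assume "\<not> 0 \<le> m"
    then have "copositive (A - m *\<^sub>R outer_square 1)"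
      using bound by (simp add: copositive_def quadratic_A_shift)
    moreover have "y \<noteq> 0"
      using y(1) by (auto simp: D_def total_def)
    moreover have "y \<bullet> ((A - m *\<^sub>R outer_square 1) *v y) = 0"
      using y(1) by (simp add: quadratic_A_shift D_def m_def)
    ultimately obtain k where "y $ k = 0" "y $ S k = 0"
      using minimizer_adjacent_zeros[of m y] \<open>\<not> 0 \<le> m\<close> y(1) by (auto simp: D_def)
    then show False
      using quadratic_A_nonneg_adjacent_zeros \<open>\<not> 0 \<le> m\<close> by (auto simp: m_def)
  qed
  then show ?thesis
    using bound unfolding copositive_def by (meson mult_nonneg_nonneg order_trans zero_le_power2)
qed

text \<open>Without a shift (\<open>m = 0\<close>) the minimizer lemma applies to every nonzero zero
  of the form and yields the edge on which it vanishes.\<close>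

lemma zero_of_A:
  assumes "\<And>i. 0 \<le> x $ i" "x \<bullet> (A *v x) = 0"
  shows "\<exists>k c. x = c *\<^sub>R u k"
proof (cases "x = 0")
  case True
  then show ?thesis
    by (metis scaleR_zero_left)
next
  case False
  then obtain k where "x $ k = 0" "x $ S k = 0"
    using minimizer_adjacent_zeros[of 0 x] assms copositive_A by auto
  then show ?thesis
    using quadratic_A_zero_adjacent_zeros assms(2) by blast
qed

lemma quadratic_A_u: "u k \<bullet> (A *v u k) = 0"
  by (simp add: A_mult_u inner_add_right inner_axis)

section \<open>Uniqueness of the supporting form and maximality of the face\<close>

lemma maximum_principle:
  fixes D :: "'n \<Rightarrow> real"
  assumes D: "\<And>h. q * D (S h) + p * (D h + D (S h) + D (S (S h))) = 0" and p: "0 < p" "p < q"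
  shows "D i = 0"
proof -
  have "Max (range (\<lambda>j. \<bar>D j\<bar>)) \<in> range (\<lambda>j. \<bar>D j\<bar>)"
    by (intro Max_in) auto
  then obtain l where l: "Max (range (\<lambda>j. \<bar>D j\<bar>)) = \<bar>D l\<bar>"
    by blast
  have le: "\<bar>D j\<bar> \<le> \<bar>D l\<bar>" for j
    unfolding l[symmetric] by (intro Max_ge) auto
  obtain h where h: "l = S h"
    using surj_S by blast
  \<comment> \<open>Where the modulus is largest, the two neighbours contribute at most
    \<open>2 * p\<close> times it, too little to balance \<open>q + p\<close>.\<close>
  have "(q + p) * D l = - p * (D h + D (S l))"
    using D[of h] by (simp add: h algebra_simps)
  then have "(q + p) * \<bar>D l\<bar> = p * \<bar>D h + D (S l)\<bar>"
    using p by (metis abs_minus_cancel abs_mult abs_of_pos add_pos_pos less_trans mult_minus_left)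
  also have "\<dots> \<le> p * (\<bar>D l\<bar> + \<bar>D l\<bar>)"
    using p le[of h] le[of "S l"] by (intro mult_left_mono) linarith+
  finally have "(q - p) * \<bar>D l\<bar> \<le> 0"
    by (simp add: algebra_simps)
  then have "D l = 0"
    using p by (simp add: mult_le_0_iff)
  then show ?thesis
    using le[of i] by simp
qed

lemma cos_5d_less: "cos (5 * d) < cos (3 * d)"
  using d_pos d_le by (intro cos_monotone_0_pi) auto

text \<open>Seen from the midpoint of the edge, these vertices lie at angles \<open>3 * d\<close>
  and \<open>5 * d\<close>.\<close>

lemma u_second:
  "u (S k) $ k = \<alpha> - cos (3 * d)" "u k $ S (S k) = \<alpha> - cos (3 * d)"
  "u (S (S k)) $ k = \<alpha> - cos (5 * d)" "u k $ S (S (S k)) = \<alpha> - cos (5 * d)"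
proof -
  have 1: "cos (\<theta> (S k) - \<theta> k + t) = cos (2 * d + t)" for t
    using cos_theta_S[of k "t - \<theta> k"] by (simp add: algebra_simps)
  have 2: "cos (\<theta> (S (S k)) - \<theta> k + t) = cos (4 * d + t)" for t
    using cos_theta_S[of "S k" "t - \<theta> k"] 1[of "2 * d + t"] by (simp add: algebra_simps)
  have 3: "cos (\<theta> (S (S (S k))) - \<theta> k + t) = cos (6 * d + t)" for t
    using cos_theta_S[of "S (S k)" "t - \<theta> k"] 2[of "2 * d + t"] by (simp add: algebra_simps)
  have swap: "cos (x - (y + d)) = cos (y - x + d)" for x y
    using cos_minus[of "x - (y + d)"] by (simp add: algebra_simps)
  have shift: "cos (x - (y + d)) = cos (x - y + - d)" for x y
    by (simp add: algebra_simps)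
  show "u (S k) $ k = \<alpha> - cos (3 * d)" "u (S (S k)) $ k = \<alpha> - cos (5 * d)"
    using S_distinct[of k] 1[of d] 2[of d] by (simp_all add: u_def swap)
  show "u k $ S (S k) = \<alpha> - cos (3 * d)" "u k $ S (S (S k)) = \<alpha> - cos (5 * d)"
    using S_distinct[of k] S_distinct[of "S k"] 2[of "- d"] 3[of "- d"] by (simp_all add: u_def shift)
qed

text \<open>Pairing \<open>u k\<close> with \<open>A *v z\<close> gives a multiple of
  \<open>z $ k + z $ S k\<close>, so vanishing for all \<open>k\<close> forces \<open>z = 0\<close>.
  Hence \<open>A\<close> is injective, thus surjective, and every \<open>y\<close> has the form
  \<open>A *v z\<close>.\<close>

lemma orthogonal_to_all_u:
  assumes "\<And>k. u k \<bullet> y = 0"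
  shows "y = 0"
proof -
  have dual: "u k \<bullet> (A *v z) = \<epsilon> * (z $ k + z $ S k)" for k z
  proof -
    have "u k \<bullet> (A *v z) = (A *v u k) \<bullet> z"
      using dot_lmul_matrix[of "u k" A z] transpose_A
      by (simp add: vector_transpose_matrix flip: transpose_matrix_vector)
    then show ?thesis
      by (simp add: A_mult_u inner_add_left inner_axis')
  qed
  have zero: "z = 0" if "\<And>k. u k \<bullet> (A *v z) = 0" for z
  proof -
    have "z $ k + z $ S k = 0" for k
      using that[of k] eps_pos unfolding dual by simp
    then have "z $ k = 0" for k
      by (rule zero_of_S_alternating[of "\<lambda>k. z $ k"])
    then show ?thesis
      by (simp add: vec_eq_iff)
  qed
  have "inj ((*v) A)"
    unfolding linear_injective_0[OF matrix_vector_mul_linear]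
    by (intro allI impI zero) simp
  then have "surj ((*v) A)"
    by (intro linear_injective_imp_surjective) auto
  then obtain z where "y = A *v z"
    by (metis surjD)
  then have "z = 0"
    using assms by (intro zero) simp
  then show ?thesis
    using \<open>y = A *v z\<close> by simp
qed

lemma copositive_proportional:
  fixes B :: "real^'n^'n"
  assumes sym: "transpose B = B" and B: "copositive B" and zero: "\<And>k. u k \<bullet> (B *v u k) = 0"
  shows "\<exists>c. B = c *\<^sub>R A"
proof -
  define \<gamma> \<delta> where "\<gamma> k = (B *v u k) $ k" and "\<delta> k = (B *v u k) $ S k" for k
  define p q where "p = \<alpha> - cos (3 * d)" and "q = \<alpha> - cos (5 * d)"
  have pq: "0 < p" "p < q"
    using cos_3d_less_alpha cos_5d_less by (simp_all add: p_def q_def)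
  note u_second = u_second[folded p_def q_def]
  have Bu: "B *v u k = \<gamma> k *\<^sub>R axis k 1 + \<delta> k *\<^sub>R axis (S k) 1" for k
  proof -
    have "(B *v u k) $ j = 0" if "j \<noteq> k" "j \<noteq> S k" for j
      using copositive_zero(2)[OF sym B u_nonneg zero u_pos[OF that]] .
    then show ?thesis
      using S_distinct(1)[of k] by (auto simp: vec_eq_iff axis_def \<gamma>_def \<delta>_def)
  qed
  have "u l \<bullet> (B *v u k) = u k \<bullet> (B *v u l)" for k l
    using dot_lmul_matrix[of "u l" B "u k"] sym
    by (simp add: vector_transpose_matrix inner_commute flip: transpose_matrix_vector)
  then have symm: "\<gamma> k * u l $ k + \<delta> k * u l $ S k = \<gamma> l * u k $ l + \<delta> l * u k $ S l" for k l
    unfolding Bu by (simp add: inner_add_right inner_axis)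
  \<comment> \<open>Symmetry of \<open>B\<close> for neighbouring edges, where one term on each side
    hits a zero of \<open>u\<close>.\<close>
  have \<delta>: "\<delta> (S k) = \<gamma> k" for k
    using symm[of k "S k"] pq by (simp add: u_second)
  have "\<gamma> (S h) - \<gamma> h = 0" for h
  proof (rule maximum_principle[OF _ pq])
    fix h
    \<comment> \<open>Symmetry of \<open>B\<close> for edges two steps apart. The three consecutive
      differences telescope, which brings the relation into the shape of the maximum
      principle.\<close>
    show "q * (\<gamma> (S (S h)) - \<gamma> (S h)) + p * ((\<gamma> (S h) - \<gamma> h) + (\<gamma> (S (S h)) - \<gamma> (S h))
        + (\<gamma> (S (S (S h))) - \<gamma> (S (S h)))) = 0"
      using symm[of "S h" "S (S (S h))"] by (simp add: u_second \<delta> algebra_simps)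
  qed
  then have const: "\<gamma> k = \<gamma> l" for k l
    using const_of_S_invariant[of \<gamma> k l] by simp
  define c where "c = \<gamma> undefined / \<epsilon>"
  have \<gamma>_eq: "\<gamma> k = \<epsilon> * c" for k
    using const[of k undefined] eps_pos by (simp add: c_def)
  have "\<delta> k = \<epsilon> * c" for k
    by (metis surj_S \<delta> \<gamma>_eq)
  \<comment> \<open>\<open>B\<close> and \<open>c *\<^sub>R A\<close> agree on every
    \<open>u k\<close>, so each row of the difference is orthogonal to all of them.\<close>
  then have "(B - c *\<^sub>R A) *v u k = 0" for k
    by (simp add: \<gamma>_eq matrix_vector_mult_diff_rdistrib Bu A_mult_u scaleR_add_right mult.commute
        scaleR_matrix_vector_assoc[symmetric] del: scaleR_matrix_vector_assoc)
  then have "u k \<bullet> ((B - c *\<^sub>R A) $ i) = 0" for i k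
    by (metis inner_commute matrix_vector_mul_component zero_index)
  then have "(B - c *\<^sub>R A) $ i = 0" for i
    using orthogonal_to_all_u by blast
  then have "B - c *\<^sub>R A = 0"
    by (simp add: vec_eq_iff)
  then show ?thesis
    by (metis eq_iff_diff_eq_0)
qed

lemma maximal_face_exposed_A: "maximal_face_of (exposed A) completely_positive_cone"
proof -
  have "exposed A \<noteq> completely_positive_cone"
  proof
    assume "exposed A = completely_positive_cone"
    then have "outer_square (1 :: real^'n) \<in> exposed A"
      by (simp add: outer_square_in_cone)
    \<comment> \<open>The all-ones vector has no zero entry, whereas every multiple of
      \<open>u k\<close> vanishes at \<open>k\<close>.\<close>
    then obtain k c where "(1 :: real^'n) = c *\<^sub>R u k"
      using zero_of_A[of 1] by (auto simp: exposed_def inner_outer_square)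
    then have "(1 :: real^'n) $ k = (c *\<^sub>R u k) $ k"
      by simp
    then show False
      by simp
  qed
  moreover have "F \<subseteq> exposed A"
    if F: "F \<noteq> {}" "F face_of completely_positive_cone" "F \<noteq> completely_positive_cone" "exposed A \<subset> F" for F
  proof -
    obtain B where B: "transpose B = B" "copositive B" "B \<noteq> 0" "F \<subseteq> exposed B"
      using proper_face_in_exposed[OF F(2,1,3)] by blast
    have "outer_square (u k) \<in> exposed A" for k
      by (simp add: exposed_def outer_square_in_cone u_nonneg inner_outer_square quadratic_A_u)
    then have "outer_square (u k) \<in> exposed B" for k
      using F(4) B(4) by blast
    then have "u k \<bullet> (B *v u k) = 0" for k
      by (simp add: exposed_def inner_outer_square)
    \<comment> \<open>As \<open>B\<close> is nonzero, so is \<open>c\<close>, and the two matrices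
      expose the same face.\<close>
    then obtain c where "B = c *\<^sub>R A"
      using copositive_proportional B(1,2) by blast
    then show ?thesis
      using B(3,4) by (auto simp: exposed_def)
  qed
  ultimately show ?thesis
    using exposed_face_of[OF copositive_A] zero_in_exposed[of A]
    unfolding maximal_face_of_def by blast
qed

text \<open>In a decomposition of \<open>X\<close>, every term with nonzero coefficient is the
  square of a zero of the form, hence a multiple of one of the \<open>n\<close> squares of the
  \<open>u k\<close>.\<close>

lemma aff_dim_exposed_A_le: "aff_dim (exposed A) \<le> int CARD('n)"
proof -
  let ?U = "range (\<lambda>k. outer_square (u k))"
  have "exposed A \<subseteq> span ?U"
  proof
    fix X assume X: "X \<in> exposed A"
    then have "X \<in> completely_positive_cone"
      by (simp add: exposed_def)
    then show "X \<in> span ?U"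
    proof (cases rule: completely_positive_coneE)
      case (1 T c)
      have gen: "\<exists>x. (\<forall>i. 0 \<le> x $ i) \<and> Y = outer_square x \<and> A \<bullet> Y = x \<bullet> (A *v x)" if "Y \<in> T" for Y
        using 1(4)[OF that] by (auto simp: inner_outer_square)
      have "(\<Sum>Y\<in>T. c Y * (A \<bullet> Y)) = 0"
        using X unfolding exposed_def by (simp add: 1(3) inner_sum_right)
      moreover have "0 \<le> c Y * (A \<bullet> Y)" if Y: "Y \<in> T" for Y
      proof -
        obtain x where "\<forall>i. 0 \<le> x $ i" "A \<bullet> Y = x \<bullet> (A *v x)"
          using gen[OF Y] by blast
        then have "0 \<le> A \<bullet> Y"
          using copositive_A by (simp add: copositive_def)
        then show ?thesis
          using 1(2) Y by simp
      qed
      ultimately have zero: "c Y * (A \<bullet> Y) = 0" if "Y \<in> T" for Y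
        using that by (subst (asm) sum_nonneg_eq_0_iff[OF 1(1)]) auto
      have "c Y *\<^sub>R Y \<in> span ?U" if Y: "Y \<in> T" for Y
      proof (cases "c Y = 0")
        case False
        obtain x where x: "\<forall>i. 0 \<le> x $ i" "Y = outer_square x" "x \<bullet> (A *v x) = 0"
          using gen[OF Y] zero[OF Y] False by auto
        then obtain k r where "x = r *\<^sub>R u k"
          using zero_of_A[of x] by auto
        then have "Y = (r * r) *\<^sub>R outer_square (u k)"
          by (simp add: x(2) vec_eq_iff)
        moreover have "outer_square (u k) \<in> span ?U"
          by (simp add: span_base)
        ultimately have "Y \<in> span ?U"
          by (simp add: span_mul)
        then show ?thesis
          by (rule span_mul)
      qed (simp add: span_0)
      then show ?thesis
        unfolding 1(3) by (rule span_sum)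
    qed
  qed
  then have "aff_dim (exposed A) \<le> aff_dim (span ?U)"
    by (rule aff_dim_subset)
  also have "\<dots> = int (dim ?U)"
    by (simp add: aff_dim_subspace)
  also have "\<dots> \<le> int CARD('n)"
    using dim_le_card[of ?U ?U] card_image_le[of UNIV "\<lambda>k. outer_square (u k)"]
    by (auto simp: span_superset intro: order_trans)
  finally show ?thesis .
qed

end

theorem theorem3:
  assumes "odd CARD('n::finite)" and "CARD('n) \<ge> 5"
  shows "low TYPE('n) = int CARD('n)"
proof (rule antisym)
  obtain pos :: "'n \<Rightarrow> nat" where "bij_betw pos UNIV {0..<CARD('n)}"
    using ex_bij_betw_finite_nat[OF finite, of "UNIV :: 'n set"] by blast
  then interpret cyclic_indexing pos
    using assms by unfold_locales (simp_all add: atLeast0LessThan)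
  have "low TYPE('n) \<le> aff_dim (exposed A)"
    unfolding low_def using maximal_face_exposed_A by (intro Min_le finite_aff_dims) blast
  then show "low TYPE('n) \<le> int CARD('n)"
    using aff_dim_exposed_A_le by linarith
  obtain F :: "(real^'n^'n) set" where "maximal_face_of F completely_positive_cone" "aff_dim F = low TYPE('n)"
    using low_attained by blast
  then show "int CARD('n) \<le> low TYPE('n)"
    using aff_dim_maximal_face_ge[of F] assms(2) by simp
qed

end
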